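(* The following hold. (a) There is $n_0$ such that for all $n\geq n_0$ and all $k$: if a protocol $\mathcal{P}\in\mathcal{D}_3(k)$ with function $f:[k]^3\to[k]$ is an $(n/4,\,1/4)$-solver for plurality consensus on $n$ nodes, then $f$ has the clear-majority property. (b) There exist a constant $\eta>0$ and $n_0$ such that for all $n\geq n_0$ and all $k$: if a protocol $\mathcal{P}\in\mathcal{D}_3(k)$ with function $f:[k]^3\to[k]$ is an $(\eta\cdot n,\,1/4)$-solver for plurality consensus on $n$ nodes, then $f$ has the uniform property.
   Context: There are $n$ nodes, each holding a color in $[k]=\{1,\dots,k\}$. A configuration is the tuple $(c_1,\dots,c_k)$ of non-negative integers summing to $n$, with $c_j$ the number of nodes of color $j$. Its plurality color is the most frequent color, and its bias is the difference between the largest and the second largest entries. A configuration is $s$-biased if its bias is at least $s$. $\mathcal{D}_3(k)$ is the class of 3-dynamics: synchronous protocols specified by a function $f:[k]^3\to[k]$ with $f(x_1,x_2,x_3)\in\{x_1,x_2,x_3\}$; at each round every node, independently, picks three nodes uniformly at random (including itself and with repetition), sees the ordered sequence $(x_1,x_2,x_3)$ of their current colors, and recolors itself with $f(x_1,x_2,x_3)$. All nodes update simultaneously. Clear-majority property: a triple $(x_1,x_2,x_3)\in[k]^3$ has a clear majority if at least two of its three entries are equal; $f$ has the clear-majority property if on every triple with a clear majority it returns the majority color. Uniform property: for distinct colors $r,g,b\in[k]$, let $\Pi(r,g,b)$ be the set of the six permutations of $(r,g,b)$, and for $y\in\{r,g,b\}$ let $\delta_y=|\{(z_1,z_2,z_3)\in\Pi(r,g,b):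 f(z_1,z_2,z_3)=y\}|$ (so $\delta_r+\delta_g+\delta_b=6$). Then $f$ has the uniform property if $\delta_r=\delta_g=\delta_b=2$ for every triple of distinct colors $r,g,b\in[k]$. $(s,\varepsilon)$-solver: a protocol $\mathcal{P}$ is an $(s,\varepsilon)$-solver for plurality consensus if, for every $s$-biased initial configuration $\mathbf{c}$, when running $\mathcal{P}$ from $\mathbf{c}$, with probability at least $1-\varepsilon$ there is a round $t$ by which all nodes have the plurality color of $\mathbf{c}$. *)

theory Defs
  imports "HOL-Probability.Probability"
begin

text \<open>
  The nodes are \<open>{..<n}\<close> and the colors are \<open>{1..k}\<close>, both inside \<^typ>\<open>nat\<close>.
  A node coloring is a function from nodes to colors; a configuration is the vector
  of color counts.
\<close>

type_synonym color = nat
type_synonym coloring = "nat \<Rightarrow> color"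
type_synonym config = "color \<Rightarrow> nat"

definition configuration :: "nat \<Rightarrow> nat \<Rightarrow> config \<Rightarrow> bool" where
  "configuration n k c \<longleftrightarrow> (\<Sum>j\<in>{1..k}. c j) = n"

definition has_configuration :: "nat \<Rightarrow> nat \<Rightarrow> coloring \<Rightarrow> config \<Rightarrow> bool" where
  "has_configuration n k x c \<longleftrightarrow>
     (\<forall>v<n. x v \<in> {1..k}) \<and> (\<forall>j\<in>{1..k}. card {v. v < n \<and> x v = j} = c j)"

text \<open>In case of ties \<open>plurality_color\<close> is an arbitrary most frequent color.\<close>

definition plurality_color :: "nat \<Rightarrow> config \<Rightarrow> color" where
  "plurality_color k c = arg_max_on c {1..k}"

text \<open>
  The second largest entry counts multiplicities (it equals the largest entry in case of a tie).
  The \<open>insert 0\<close> only matters for \<open>k = 1\<close>, where there is no other entry.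
\<close>

definition second_largest :: "nat \<Rightarrow> config \<Rightarrow> nat" where
  "second_largest k c = Max (insert 0 (c ` ({1..k} - {plurality_color k c})))"

definition bias :: "nat \<Rightarrow> config \<Rightarrow> real" where
  "bias k c = real (Max (c ` {1..k})) - real (second_largest k c)"

definition biased :: "nat \<Rightarrow> real \<Rightarrow> config \<Rightarrow> bool" where
  "biased k s c \<longleftrightarrow> bias k c \<ge> s"

text \<open>Only the values of \<open>f\<close> on triples over \<open>{1..k}\<close> are relevant.\<close>

definition three_dynamics :: "nat \<Rightarrow> (color \<times> color \<times> color \<Rightarrow> color) \<Rightarrow> bool" where
  "three_dynamics k f \<longleftrightarrow>
     (\<forall>x1\<in>{1..k}. \<forall>x2\<in>{1..k}. \<forall>x3\<in>{1..k}. f (x1, x2, x3) \<in> {x1, x2, x3})"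

text \<open>
  The random choices of one round: independently for each node, an ordered triple of nodes
  chosen uniformly, with repetition. The value \<open>(0, 0, 0)\<close> is a dummy for arguments
  that are not nodes.
\<close>

definition round_choices :: "nat \<Rightarrow> (nat \<Rightarrow> nat \<times> nat \<times> nat) pmf" where
  "round_choices n =
     Pi_pmf {..<n} (0, 0, 0) (\<lambda>_. pmf_of_set ({..<n} \<times> {..<n} \<times> {..<n}))"

definition update ::
  "(color \<times> color \<times> color \<Rightarrow> color) \<Rightarrow> (nat \<Rightarrow> nat \<times> nat \<times> nat) \<Rightarrow> coloring \<Rightarrow> coloring" where
  "update f u x = (\<lambda>v. case u v of (a, b, c) \<Rightarrow> f (x a, x b, x c))"

primrec run ::
  "(color \<times> color \<times> color \<Rightarrow> color) \<Rightarrow> coloring \<Rightarrow> (nat \<Rightarrow> nat \<times> nat \<times> nat) stream \<Rightarrow>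
     nat \<Rightarrow> coloring" where
  "run f x \<omega> 0 = x"
| "run f x \<omega> (Suc t) = update f (\<omega> !! t) (run f x \<omega> t)"

definition choices :: "nat \<Rightarrow> (nat \<Rightarrow> nat \<times> nat \<times> nat) stream measure" where
  "choices n = stream_space (measure_pmf (round_choices n))"

text \<open>
  The process starts from an arbitrary node coloring realizing the given configuration;
  which one is irrelevant, as nodes sample uniformly.
\<close>

definition solver ::
  "nat \<Rightarrow> nat \<Rightarrow> (color \<times> color \<times> color \<Rightarrow> color) \<Rightarrow> real \<Rightarrow> real \<Rightarrow> bool" where
  "solver n k f s \<epsilon> \<longleftrightarrow>
     (\<forall>c x. configuration n k c \<longrightarrow> biased k s c \<longrightarrow> has_configuration n k x c \<longrightarrow>
        \<P>(\<omega> in choices n. \<exists>t. \<forall>v<n. run f x \<omega> t v = plurality_color k c) \<ge> 1 - \<epsilon>)"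

fun clear_majority :: "color \<times> color \<times> color \<Rightarrow> bool" where
  "clear_majority (x1, x2, x3) \<longleftrightarrow> x1 = x2 \<or> x1 = x3 \<or> x2 = x3"

text \<open>Meaningful only for triples with a clear majority.\<close>

fun majority_color :: "color \<times> color \<times> color \<Rightarrow> color" where
  "majority_color (x1, x2, x3) = (if x1 = x2 \<or> x1 = x3 then x1 else x2)"

definition clear_majority_property ::
  "nat \<Rightarrow> (color \<times> color \<times> color \<Rightarrow> color) \<Rightarrow> bool" where
  "clear_majority_property k f \<longleftrightarrow>
     (\<forall>x \<in> {1..k} \<times> {1..k} \<times> {1..k}. clear_majority x \<longrightarrow> f x = majority_color x)"

definition perms3 :: "color \<Rightarrow> color \<Rightarrow> color \<Rightarrow> (color \<times> color \<times> color) set" where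
  "perms3 r g b = {(r, g, b), (r, b, g), (g, r, b), (g, b, r), (b, r, g), (b, g, r)}"

definition delta ::
  "(color \<times> color \<times> color \<Rightarrow> color) \<Rightarrow> color \<Rightarrow> color \<Rightarrow> color \<Rightarrow> color \<Rightarrow> nat" where
  "delta f r g b y = card {z \<in> perms3 r g b. f z = y}"

definition uniform_property :: "nat \<Rightarrow> (color \<times> color \<times> color \<Rightarrow> color) \<Rightarrow> bool" where
  "uniform_property k f \<longleftrightarrow>
     (\<forall>r\<in>{1..k}. \<forall>g\<in>{1..k}. \<forall>b\<in>{1..k}. r \<noteq> g \<and> r \<noteq> b \<and> g \<noteq> b \<longrightarrow>
        delta f r g b r = 2 \<and> delta f r g b g = 2 \<and> delta f r g b b = 2)"

lemma prob_space_choices: "prob_space (choices n)"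
  unfolding choices_def
  by (intro prob_space.prob_space_stream_space measure_pmf.prob_space_axioms)

lemma measurable_run:
  "(\<lambda>\<omega>. run f x \<omega> t v) \<in> measurable (choices n) (count_space UNIV)"
proof (induction t arbitrary: v)
  case 0
  show ?case by simp
next
  case (Suc t)
  have snth: "(\<lambda>\<omega>. (\<omega> !! t) v) \<in> measurable (choices n) (count_space UNIV)"
    unfolding choices_def
    by (rule measurable_compose[where f = "\<lambda>\<omega>. \<omega> !! t" and g = "\<lambda>u. u v", OF measurable_snth]) simp
  have 1: "(\<lambda>\<omega>. f (p, q, run f x \<omega> t c)) \<in> measurable (choices n) (count_space UNIV)" for p q c
    by (rule measurable_compose[where g = "\<lambda>r. f (p, q, r)", OF Suc.IH]) simp
  have 2: "(\<lambda>\<omega>. f (p, run f x \<omega> t b, run f x \<omega> t c)) \<in> measurable (choices n) (count_space UNIV)" for p b c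
    by (rule measurable_compose_countable[where f = "\<lambda>q \<omega>. f (p, q, run f x \<omega> t c)", OF 1 Suc.IH])
  have 3: "(\<lambda>\<omega>. f (run f x \<omega> t a, run f x \<omega> t b, run f x \<omega> t c)) \<in> measurable (choices n) (count_space UNIV)" for a b c
    by (rule measurable_compose_countable[where f = "\<lambda>p \<omega>. f (p, run f x \<omega> t b, run f x \<omega> t c)", OF 2 Suc.IH])
  define h where "h = (\<lambda>i \<omega>. case i of (a, b, c) \<Rightarrow> f (run f x \<omega> t a, run f x \<omega> t b, run f x \<omega> t c))"
  have h: "h i \<in> measurable (choices n) (count_space UNIV)" for i
    using 3 by (cases i) (simp add: h_def)
  have "(\<lambda>\<omega>. h ((\<omega> !! t) v) \<omega>) \<in> measurable (choices n) (count_space UNIV)"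
    by (rule measurable_compose_countable[where f = h, OF h snth])
  then show ?case
    unfolding h_def run.simps update_def .
qed

text \<open>The event in the definition of \<open>solver\<close> is measurable.\<close>

lemma measurable_consensus:
  "{\<omega> \<in> space (choices n). \<exists>t. \<forall>v<n. run f x \<omega> t v = m} \<in> sets (choices n)"
proof -
  have [measurable]: "Measurable.pred (choices n) (\<lambda>\<omega>. run f x \<omega> t v = m)" for t v
    by (rule measurable_compose[where g = "\<lambda>r. r = m", OF measurable_run]) simp
  show ?thesis by measurable
qed

end

(*
  The probability "win" that color m eventually takes over is a harmonic function of the coloring.

  (a) From two colors r, b, let A of the three arrangements of r, r, b and G of those of r, b, b be
  mapped to r. With a fraction p of the nodes colored r, the next fraction is binomial with mean
  q p = p^3 + A p^2 (1 - p) + G p (1 - p)^2. If q p - p has constant sign on [0,1], the maximum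
  principle compares the winning probability of r with p, so that one of the two colors wins from a
  5/8 majority with probability at most 5/8 + o(1). If A <= 1 and G >= 2, the chain is confined to
  the middle of [0,1], where q is a contraction; hence the winning probability varies by o(1)
  between p = 3/8 and p = 5/8, whereas a solver needs it to rise from at most 1/4 to at least 3/4.
  Only A = 3, G = 0 remains.

  (b) If g has the largest delta of r, g, b and delta_r + 2 <= delta_g, start with fractions close to
  1/3 + 1/100, 1/3, 1/3 - 1/100 of r, g, b. One round later g leads by n/100 with high probability,
  so the solver property applied to the new configuration makes g win instead of r.
*)
theory Submission
  imports Defs
begin

subsection \<open>Winning probabilities\<close>

text \<open>The event of \<open>solver\<close> with the target color left free, so that the chances
  of two colors from one coloring can be compared.\<close>

definition win :: "nat \<Rightarrow> (color \<times> color \<times> color \<Rightarrow> color) \<Rightarrow> color \<Rightarrow> coloring \<Rightarrow> real" where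
  "win n f m x = \<P>(\<omega> in choices n. \<exists>t. \<forall>v<n. run f x \<omega> t v = m)"

text \<open>Almost surely every sample is a node. The stream space also contains other choices, and
  only along valid ones is a run on the nodes determined by the initial colors of the nodes.\<close>

definition valid_choice :: "nat \<Rightarrow> (nat \<Rightarrow> nat \<times> nat \<times> nat) \<Rightarrow> bool" where
  "valid_choice n u \<longleftrightarrow> (\<forall>v<n. u v \<in> {..<n} \<times> {..<n} \<times> {..<n})"

lemma win_nonneg: "win n f m x \<ge> 0"
  and win_le_1: "win n f m x \<le> 1"
proof -
  interpret prob_space "choices n" by (rule prob_space_choices)
  show "win n f m x \<ge> 0" "win n f m x \<le> 1"
    unfolding win_def by auto
qed

lemma run_SCons: "run f x (u ## \<omega>) (Suc t) = run f (update f u x) \<omega> t"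
  by (induction t) simp_all

lemma valid_choice_round_choices:
  assumes "n > 0" "u \<in> set_pmf (round_choices n)"
  shows "valid_choice n u"
proof -
  have "u \<in> PiE_dflt {..<n} (0, 0, 0) (set_pmf \<circ> (\<lambda>_. pmf_of_set ({..<n} \<times> {..<n} \<times> {..<n})))"
    using assms(2) unfolding round_choices_def by (subst (asm) set_Pi_pmf) auto
  moreover have "set_pmf (pmf_of_set ({..<n} \<times> {..<n} \<times> {..<n})) = {..<n} \<times> {..<n} \<times> {..<n}"
    using assms(1) by (intro set_pmf_of_set) auto
  ultimately show ?thesis
    unfolding valid_choice_def PiE_dflt_def by auto
qed

lemma AE_valid_choice:
  assumes "n > 0"
  shows "AE \<omega> in choices n. \<forall>t. valid_choice n (\<omega> !! t)"
proof -
  have "AE \<omega> in choices n. stream_all (valid_choice n) \<omega>"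
    unfolding choices_def
    by (intro prob_space.AE_stream_all)
       (auto simp: measure_pmf.prob_space_axioms AE_measure_pmf_iff valid_choice_round_choices assms)
  then show ?thesis
    by (auto simp: stream_all_def elim!: eventually_mono)
qed

lemma update_cong:
  assumes "valid_choice n u" "\<And>v. v < n \<Longrightarrow> x v = y v" "v < n"
  shows "update f u x v = update f u y v"
  using assms unfolding valid_choice_def update_def by (auto split: prod.splits)

lemma run_cong:
  assumes "\<And>t. valid_choice n (\<omega> !! t)" "\<And>v. v < n \<Longrightarrow> x v = y v" "v < n"
  shows "run f x \<omega> t v = run f y \<omega> t v"
  using assms(3) by (induction t arbitrary: v) (auto intro!: update_cong[where n = n] simp: assms)

lemma update_consensus:
  assumes "valid_choice n u" "f (m, m, m) = m" "\<And>v. v < n \<Longrightarrow> x v = m" "v < n"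
  shows "update f u x v = m"
  using assms unfolding valid_choice_def update_def by (auto split: prod.splits)

lemma run_consensus:
  assumes "\<And>t. valid_choice n (\<omega> !! t)" "f (m, m, m) = m"
    "\<And>v. v < n \<Longrightarrow> run f x \<omega> s v = m" "v < n" "s \<le> t"
  shows "run f x \<omega> t v = m"
  using assms(5,4)
  by (induction t arbitrary: v rule: dec_induct) (auto intro!: update_consensus[where n = n] simp: assms)

lemma win_cong:
  assumes "n > 0" "\<And>v. v < n \<Longrightarrow> x v = y v"
  shows "win n f m x = win n f m y"
proof -
  interpret prob_space "choices n" by (rule prob_space_choices)
  have "AE \<omega> in choices n. (\<exists>t. \<forall>v<n. run f x \<omega> t v = m) \<longleftrightarrow> (\<exists>t. \<forall>v<n. run f y \<omega> t v = m)"
    using AE_valid_choice[OF assms(1)]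
  proof eventually_elim
    case (elim \<omega>)
    show ?case using run_cong[of n \<omega> x y] elim assms(2) by auto
  qed
  then show ?thesis
    unfolding win_def
    by (intro measure_eq_AE) (auto simp: measurable_consensus elim!: eventually_mono)
qed

lemma win_consensus:
  assumes "\<And>v. v < n \<Longrightarrow> x v = m"
  shows "win n f m x = 1"
proof -
  interpret prob_space "choices n" by (rule prob_space_choices)
  have "(\<forall>v<n. run f x \<omega> 0 v = m)" for \<omega> using assms by simp
  then have "{\<omega> \<in> space (choices n). \<exists>t. \<forall>v<n. run f x \<omega> t v = m} = space (choices n)"
    by blast
  then show ?thesis unfolding win_def by (simp add: prob_space)
qed

text \<open>Consensus on a color persists once \<open>f\<close> fixes its constant triple. If both
  events occurred, node 0 would have both colors at the later of the two consensus times.\<close>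

lemma win_add_le_1:
  assumes "n > 0" "m \<noteq> m'" "f (m, m, m) = m" "f (m', m', m') = m'"
  shows "win n f m x + win n f m' x \<le> 1"
proof -
  interpret prob_space "choices n" by (rule prob_space_choices)
  define A where "A m = {\<omega> \<in> space (choices n). \<exists>t. \<forall>v<n. run f x \<omega> t v = m}" for m
  have sets: "A m \<in> events" for m unfolding A_def by (rule measurable_consensus)
  have "AE \<omega> in choices n. \<omega> \<in> A m \<inter> A m' \<longleftrightarrow> \<omega> \<in> {}"
    using AE_valid_choice[OF assms(1)]
  proof eventually_elim
    case (elim \<omega>)
    have False if A: "\<omega> \<in> A m" "\<omega> \<in> A m'"
    proof -
      obtain s t where "\<forall>v<n. run f x \<omega> s v = m" "\<forall>v<n. run f x \<omega> t v = m'"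
        using A unfolding A_def by blast
      then have "run f x \<omega> (max s t) 0 = m" "run f x \<omega> (max s t) 0 = m'"
        using run_consensus[of n \<omega> f m x s 0 "max s t"]
          run_consensus[of n \<omega> f m' x t 0 "max s t"] elim assms by simp_all
      then show False using assms(2) by simp
    qed
    then show ?case by blast
  qed
  then have "prob (A m \<inter> A m') = prob {}"
    by (intro measure_eq_AE sets.Int sets sets.empty_sets)
  then have "prob (A m \<union> A m') = prob (A m) + prob (A m')"
    using measure_Un3[of "A m" "choices n" "A m'"] sets by (simp add: fmeasurable_eq_sets)
  then show ?thesis
    unfolding win_def A_def[symmetric] using prob_le_1[of "A m \<union> A m'"] by simp
qed

text \<open>First-step analysis: the stream of choices splits into its head and a tail distributed
  like the whole stream.\<close>

lemma win_round_choices: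
  assumes "n > 0" "f (m, m, m) = m"
  shows "win n f m x = measure_pmf.expectation (round_choices n) (\<lambda>u. win n f m (update f u x))"
proof -
  interpret prob_space "choices n" by (rule prob_space_choices)
  have *: "\<P>(\<omega> in choices n. \<exists>t. \<forall>v<n. run f x (u ## \<omega>) t v = m) = win n f m (update f u x)"
    if "u \<in> set_pmf (round_choices n)" for u
  proof -
    have valid: "valid_choice n u" using that assms valid_choice_round_choices by blast
    \<comment> \<open>The shifted run does not see round 0, so an initial consensus is treated
      apart; it survives the first round because of \<open>f (m, m, m) = m\<close>.\<close>
    have split: "(\<exists>t. \<forall>v<n. run f x (u ## \<omega>) t v = m) \<longleftrightarrow>
      (\<forall>v<n. x v = m) \<or> (\<exists>t. \<forall>v<n. run f (update f u x) \<omega> t v = m)" (is "?L \<longleftrightarrow> ?R") for \<omega>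
    proof -
      have "?L \<longleftrightarrow> (\<forall>v<n. run f x (u ## \<omega>) 0 v = m) \<or> (\<exists>t. \<forall>v<n. run f x (u ## \<omega>) (Suc t) v = m)"
        by (metis not0_implies_Suc)
      then show ?thesis by (simp only: run_SCons run.simps(1))
    qed
    show ?thesis
    proof (cases "\<forall>v<n. x v = m")
      case True
      then have "win n f m (update f u x) = 1"
        using valid assms by (intro win_consensus update_consensus) auto
      then show ?thesis using True by (simp add: split prob_space)
    next
      case False
      then have "(\<exists>t. \<forall>v<n. run f x (u ## \<omega>) t v = m) \<longleftrightarrow>
        (\<exists>t. \<forall>v<n. run f (update f u x) \<omega> t v = m)" for \<omega>
        using split by blast
      then show ?thesis by (simp only: win_def)
    qed
  qed
  have "ennreal (win n f m x) =
     (\<integral>\<^sup>+u. \<P>(\<omega> in choices n. \<exists>t. \<forall>v<n. run f x (u ## \<omega>) t v = m) \<partial>measure_pmf (round_choices n))"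
    unfolding win_def
    by (rule prob_space.prob_stream_space[OF measure_pmf.prob_space_axioms measurable_consensus[unfolded choices_def],
          folded choices_def])
  also have "\<dots> = (\<integral>\<^sup>+u. ennreal (win n f m (update f u x)) \<partial>measure_pmf (round_choices n))"
    by (intro nn_integral_cong_AE) (simp add: AE_measure_pmf_iff *)
  also have "\<dots> = ennreal (measure_pmf.expectation (round_choices n) (\<lambda>u. win n f m (update f u x)))"
    by (intro nn_integral_eq_integral measure_pmf.integrable_const_bound[where B = 1])
       (auto simp: win_nonneg win_le_1)
  finally show ?thesis
    by (subst (asm) ennreal_inj) (auto simp: win_nonneg intro!: Bochner_Integration.integral_nonneg)
qed

section \<open>The law of one round\<close>

definition color_law ::
  "nat \<Rightarrow> (color \<times> color \<times> color \<Rightarrow> color) \<Rightarrow> coloring \<Rightarrow> color pmf" where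
  "color_law n f x =
     map_pmf (\<lambda>(a, b, c). f (x a, x b, x c)) (pmf_of_set ({..<n} \<times> {..<n} \<times> {..<n}))"

definition color_count :: "nat \<Rightarrow> coloring \<Rightarrow> config" where
  "color_count n x j = card {v. v < n \<and> x v = j}"

text \<open>All nodes sample independently and in the same way, so the next colors are i.i.d. with
  law \<open>color_law\<close>.\<close>

lemma win_color_law:
  assumes "n > 0" "f (m, m, m) = m"
  shows "win n f m x = measure_pmf.expectation (Pi_pmf {..<n} d (\<lambda>_. color_law n f x)) (win n f m)"
proof -
  \<comment> \<open>Non-nodes receive the dummy choice \<open>(0, 0, 0)\<close>, which
    \<open>update\<close> turns into this color.\<close>
  let ?d = "f (x 0, x 0, x 0)"
  let ?F = "\<lambda>(a, b, c). f (x a, x b, x c)"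
  have upd: "(\<lambda>u. update f u x) = (\<lambda>u. ?F \<circ> u)"
    by (auto simp: update_def fun_eq_iff)
  have "Pi_pmf {..<n} ?d (\<lambda>_. color_law n f x) = map_pmf (\<lambda>u. update f u x) (round_choices n)"
    unfolding color_law_def round_choices_def upd by (rule Pi_pmf_map) auto
  then have "win n f m x = measure_pmf.expectation (Pi_pmf {..<n} ?d (\<lambda>_. color_law n f x)) (win n f m)"
    using win_round_choices[where f = f and x = x, OF assms] by simp
  \<comment> \<open>\<open>win\<close> ignores the colors of non-nodes, so any default
    \<open>d\<close> can take the place of \<open>?d\<close>.\<close>
  also have "\<dots> = measure_pmf.expectation (Pi_pmf {..<n} ?d (\<lambda>_. color_law n f x))
      (\<lambda>y. win n f m (\<lambda>v. if v \<in> {..<n} then y v else d))"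
    using assms by (intro Bochner_Integration.integral_cong win_cong) auto
  also have "\<dots> = measure_pmf.expectation (Pi_pmf {..<n} d (\<lambda>_. color_law n f x)) (win n f m)"
    by (subst Pi_pmf_default_swap[of _ d ?d, symmetric]) auto
  finally show ?thesis .
qed

text \<open>Each node is an independent Bernoulli trial for having color \<open>m\<close>, and the
  count is the number of successes.\<close>

lemma map_color_count_Pi_pmf:
  "map_pmf (\<lambda>y. color_count n y m) (Pi_pmf {..<n} d (\<lambda>_. P)) = binomial_pmf n (pmf P m)"
proof -
  have "map_pmf (\<lambda>c. c = m) P = bernoulli_pmf (pmf P m)"
  proof (rule pmf_eqI)
    have T: "pmf (map_pmf (\<lambda>c. c = m) P) True = pmf P m"
      by (simp add: pmf_map vimage_def measure_pmf_single)
    fix b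
    have "pmf (map_pmf (\<lambda>c. c = m) P) False = 1 - pmf (map_pmf (\<lambda>c. c = m) P) True"
      by (rule pmf_False_conv_True)
    with T show "pmf (map_pmf (\<lambda>c. c = m) P) b = pmf (bernoulli_pmf (pmf P m)) b"
      by (cases b) (auto simp: pmf_le_1)
  qed
  moreover have "Pi_pmf {..<n} (d = m) (\<lambda>_. map_pmf (\<lambda>c. c = m) P) =
      map_pmf (\<lambda>y. (\<lambda>c. c = m) \<circ> y) (Pi_pmf {..<n} d (\<lambda>_. P))"
    by (rule Pi_pmf_map) auto
  moreover have "binomial_pmf n (pmf P m) =
      map_pmf (\<lambda>y. card {v \<in> {..<n}. y v}) (Pi_pmf {..<n} (d = m) (\<lambda>_. bernoulli_pmf (pmf P m)))"
    by (rule binomial_pmf_altdef') (auto simp: pmf_le_1)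
  ultimately show ?thesis
    by (simp add: map_pmf_comp color_count_def)
qed

text \<open>Groups the n^3 equally likely samples by the colors they show. \<open>S\<close> may
  exceed the set of colors present, so that two colorings can be expanded over a common set.\<close>

lemma pmf_color_law:
  assumes "n > 0" "finite S" "\<And>v. v < n \<Longrightarrow> x v \<in> S"
  shows "pmf (color_law n f x) y = (\<Sum>i\<in>S. \<Sum>j\<in>S. \<Sum>l\<in>S.
     real (color_count n x i) / n * (real (color_count n x j) / n) * (real (color_count n x l) / n) *
     of_bool (f (i, j, l) = y))"
proof -
  have group: "(\<Sum>v<n. g (x v)) = (\<Sum>i\<in>S. real (color_count n x i) * g i)" for g :: "nat \<Rightarrow> real"
  proof -
    have "(\<Sum>v<n. g (x v)) = (\<Sum>i\<in>S. \<Sum>v\<in>{v \<in> {..<n}. x v = i}. g (x v))"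
      using assms by (subst sum.group) auto
    also have "\<dots> = (\<Sum>i\<in>S. real (color_count n x i) * g i)"
      by (intro sum.cong refl) (simp add: color_count_def)
    finally show ?thesis .
  qed
  let ?N = "{..<n} \<times> {..<n} \<times> {..<n}"
  let ?g = "\<lambda>i j l. of_bool (f (i, j, l) = y) :: real"
  have "?N \<noteq> {}" using assms(1) by auto
  then have "pmf (color_law n f x) y =
      real (card (?N \<inter> {t. (case t of (a, b, c) \<Rightarrow> f (x a, x b, x c)) = y})) / real (n * (n * n))"
    unfolding color_law_def pmf_map by (subst measure_pmf_of_set) (auto simp: vimage_def)
  also have "real (card (?N \<inter> {t. (case t of (a, b, c) \<Rightarrow> f (x a, x b, x c)) = y})) =
      (\<Sum>t\<in>?N. of_bool ((case t of (a, b, c) \<Rightarrow> f (x a, x b, x c)) = y))"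
    by (simp add: Int_def)
  also have "\<dots> = (\<Sum>a<n. \<Sum>b<n. \<Sum>c<n. ?g (x a) (x b) (x c))"
    by (simp add: sum.cartesian_product case_prod_unfold del: sum_of_bool_eq)
  also have "\<dots> = (\<Sum>i\<in>S. real (color_count n x i) * (\<Sum>j\<in>S. real (color_count n x j) *
      (\<Sum>l\<in>S. real (color_count n x l) * ?g i j l)))"
    by (simp only: group[of "\<lambda>l. ?g _ _ l"] group[of "\<lambda>j. \<Sum>l\<in>S. _ l * ?g _ j l"]
      group[of "\<lambda>i. \<Sum>j\<in>S. _ j * (\<Sum>l\<in>S. _ l * ?g i j l)"])
  finally show ?thesis
    by (simp add: sum_divide_distrib sum_distrib_left mult.assoc)
qed


subsection \<open>Harmonic functions of binomial chains\<close>

lemma integrable_binomial_pmf: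
  fixes h :: "nat \<Rightarrow> real"
  assumes "p \<in> {0..1}"
  shows "integrable (measure_pmf (binomial_pmf n p)) h"
proof (rule integrable_measure_pmf_finite)
  have "set_pmf (binomial_pmf n p) \<subseteq> {..n}"
    using assms by (auto simp: set_pmf_binomial_eq)
  then show "finite (set_pmf (binomial_pmf n p))"
    by (rule finite_subset) simp
qed

lemma expectation_binomial_pmf_mono:
  fixes g h :: "nat \<Rightarrow> real"
  assumes "p \<in> {0..1}" "\<And>j. j \<le> n \<Longrightarrow> g j \<le> h j"
  shows "measure_pmf.expectation (binomial_pmf n p) g \<le> measure_pmf.expectation (binomial_pmf n p) h"
  using assms
  by (intro integral_mono_AE integrable_binomial_pmf)
     (auto simp: AE_measure_pmf_iff set_pmf_binomial_eq split: if_splits)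

lemma expectation_binomial_pmf_Suc:
  fixes h :: "nat \<Rightarrow> real"
  assumes "p \<in> {0..1}"
  shows "measure_pmf.expectation (binomial_pmf (Suc n) p) h =
    p * measure_pmf.expectation (binomial_pmf n p) (\<lambda>j. h (Suc j)) +
    (1 - p) * measure_pmf.expectation (binomial_pmf n p) h"
proof -
  have "finite (set_pmf (binomial_pmf n p))"
    using assms by (auto simp: set_pmf_binomial_eq)
  moreover have "binomial_pmf (Suc n) p =
      bernoulli_pmf p \<bind> (\<lambda>b. map_pmf (\<lambda>k. (if b then 1 else 0) + k) (binomial_pmf n p))"
    using assms by (simp add: binomial_pmf_Suc map_pmf_def)
  ultimately show ?thesis
    using assms by (simp only:) (subst pmf_expectation_bind[where A = UNIV], auto simp: UNIV_bool)
qed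

lemma expectation_binomial_pmf_real:
  assumes "p \<in> {0..1}"
  shows "measure_pmf.expectation (binomial_pmf n p) real = n * p"
proof (induction n)
  case (Suc n)
  have "measure_pmf.expectation (binomial_pmf n p) (\<lambda>j. 1 + real j) = 1 + n * p"
    using Suc assms by (subst Bochner_Integration.integral_add) (auto intro!: integrable_binomial_pmf)
  then show ?case
    using Suc assms by (simp add: expectation_binomial_pmf_Suc algebra_simps)
qed (use assms in \<open>simp add: binomial_pmf_0\<close>)

text \<open>Formally, the derivative of the expectation in the success probability is n times a mean
  increment of \<open>h\<close>. Conditioning on one trial replaces calculus: it leaves the same
  differences for one trial fewer and one term \<open>p - q\<close> times a mean increment.\<close>

lemma expectation_binomial_pmf_lipschitz:
  fixes h :: "nat \<Rightarrow> real"
  assumes "p \<in> {0..1}" "q \<in> {0..1}" "\<And>j. j < n \<Longrightarrow> \<bar>h (Suc j) - h j\<bar> \<le> M"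
  shows "\<bar>measure_pmf.expectation (binomial_pmf n p) h -
    measure_pmf.expectation (binomial_pmf n q) h\<bar> \<le> n * M * \<bar>p - q\<bar>"
  using assms(3)
proof (induction n arbitrary: h)
  case 0
  then show ?case using assms by (simp add: binomial_pmf_0)
next
  case (Suc n)
  let ?E = "\<lambda>p. measure_pmf.expectation (binomial_pmf n p)"
  let ?S = "\<lambda>j. h (Suc j)"
  have "\<bar>?E p ?S - ?E q ?S\<bar> \<le> n * M * \<bar>p - q\<bar>" "\<bar>?E p h - ?E q h\<bar> \<le> n * M * \<bar>p - q\<bar>"
    by (intro Suc; simp add: Suc.prems)+
  then have 1: "\<bar>p * (?E p ?S - ?E q ?S)\<bar> \<le> p * (n * M * \<bar>p - q\<bar>)"
    and 2: "\<bar>(1 - p) * (?E p h - ?E q h)\<bar> \<le> (1 - p) * (n * M * \<bar>p - q\<bar>)"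
    using assms by (auto simp: abs_mult intro!: mult_left_mono)
  have "- M \<le> h (Suc j) - h j" "h (Suc j) - h j \<le> M" if "j \<le> n" for j
    using Suc.prems[of j] that by (auto simp: abs_le_iff)
  then have "?E q (\<lambda>j. h (Suc j) - h j) \<le> ?E q (\<lambda>_. M)" "?E q (\<lambda>_. - M) \<le> ?E q (\<lambda>j. h (Suc j) - h j)"
    using assms by (intro expectation_binomial_pmf_mono; blast)+
  moreover have "?E q (\<lambda>j. h (Suc j) - h j) = ?E q ?S - ?E q h"
    using assms by (intro Bochner_Integration.integral_diff integrable_binomial_pmf)
  ultimately have D: "\<bar>?E q ?S - ?E q h\<bar> \<le> M"
    by simp
  have 3: "\<bar>(p - q) * (?E q ?S - ?E q h)\<bar> \<le> M * \<bar>p - q\<bar>"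
    using mult_left_mono[OF D abs_ge_zero[of "p - q"]] by (simp add: abs_mult mult.commute[of M])
  have "measure_pmf.expectation (binomial_pmf (Suc n) p) h -
      measure_pmf.expectation (binomial_pmf (Suc n) q) h =
      p * (?E p ?S - ?E q ?S) + (1 - p) * (?E p h - ?E q h) + (p - q) * (?E q ?S - ?E q h)"
    using assms by (simp add: expectation_binomial_pmf_Suc algebra_simps)
  then have "\<bar>measure_pmf.expectation (binomial_pmf (Suc n) p) h -
      measure_pmf.expectation (binomial_pmf (Suc n) q) h\<bar> \<le>
      p * (n * M * \<bar>p - q\<bar>) + (1 - p) * (n * M * \<bar>p - q\<bar>) + M * \<bar>p - q\<bar>"
    using 1 2 3 by linarith
  then show ?case by (simp add: algebra_simps)
qed

text \<open>A positive maximum would sit at an interior point, where it is at most a mean of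
  \<open>u\<close>. That mean is strictly smaller, because the binomial law gives positive mass to
  0, where \<open>u\<close> is at most 0.\<close>

lemma binomial_maximum_principle:
  fixes u r :: "nat \<Rightarrow> real"
  assumes "u 0 \<le> 0" "u n \<le> 0"
    and r: "\<And>c. 0 < c \<Longrightarrow> c < n \<Longrightarrow> 0 < r c \<and> r c < 1"
    and sub: "\<And>c. 0 < c \<Longrightarrow> c < n \<Longrightarrow> u c \<le> measure_pmf.expectation (binomial_pmf n (r c)) u"
    and "c \<le> n"
  shows "u c \<le> 0"
proof (rule ccontr)
  assume neg: "\<not> u c \<le> 0"
  define m where "m = Max (u ` {..n})"
  have m_ge: "u j \<le> m" if "j \<le> n" for j
    using that unfolding m_def by (intro Max_ge) auto
  have "m \<in> u ` {..n}"
    unfolding m_def by (intro Max_in) auto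
  then obtain d where d: "d \<le> n" "u d = m" by auto
  have "m > 0" using m_ge[of c] neg assms(5) by simp
  then have d': "0 < d" "d < n"
    using d assms(1,2) by (auto intro!: gr0I le_neq_implies_less)
  let ?p = "r d"
  have p: "0 < ?p" "?p < 1" using r d' by auto
  then have int: "integrable (measure_pmf (binomial_pmf n ?p)) g" for g :: "nat \<Rightarrow> real"
    by (intro integrable_binomial_pmf) auto
  have "m \<le> measure_pmf.expectation (binomial_pmf n ?p) u"
    using sub[OF d'] d by simp
  also have "\<dots> \<le> measure_pmf.expectation (binomial_pmf n ?p) (\<lambda>j. m - m * indicator {0} j)"
    using p m_ge assms(1) by (intro expectation_binomial_pmf_mono) (auto simp: indicator_def)
  also have "\<dots> = m - m * pmf (binomial_pmf n ?p) 0"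
    using int by (simp add: measure_pmf_single)
  also have "\<dots> < m"
    using p \<open>m > 0\<close> by simp
  finally show False by simp
qed

text \<open>Let M be the largest increment of \<open>h\<close> on the interval. Averaging over one
  step shrinks increments by the factor \<theta>, up to the probability \<open>e\<close> of leaving
  the interval, so M <= \<theta> M + 2 e. At most n increments are then summed; the factor n is
  harmless when \<open>e\<close> is exponentially small.\<close>

lemma binomial_harmonic_oscillation:
  fixes h r :: "nat \<Rightarrow> real"
  assumes "n > 0" "hi \<le> n"
    and h01: "\<And>k. 0 \<le> h k \<and> h k \<le> 1"
    and r01: "\<And>k. lo \<le> k \<Longrightarrow> k \<le> hi \<Longrightarrow> r k \<in> {0..1}"
    and harm: "\<And>k. lo \<le> k \<Longrightarrow> k \<le> hi \<Longrightarrow> h k = measure_pmf.expectation (binomial_pmf n (r k)) h"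
    and tail: "\<And>k. lo \<le> k \<Longrightarrow> k \<le> hi \<Longrightarrow> measure_pmf.prob (binomial_pmf n (r k)) (- {lo..hi}) \<le> e"
    and contr: "\<And>k. lo \<le> k \<Longrightarrow> k < hi \<Longrightarrow> n * \<bar>r (Suc k) - r k\<bar> \<le> \<theta>"
    and "\<theta> < 1"
    and ab: "lo \<le> a" "a \<le> b" "b \<le> hi"
  shows "\<bar>h b - h a\<bar> \<le> n * (2 * e / (1 - \<theta>))"
proof -
  have e: "e \<ge> 0" using tail[of a] ab by (meson dual_order.trans le_trans measure_nonneg)
  have incr: "\<bar>h (Suc k) - h k\<bar> \<le> 2 * e / (1 - \<theta>)" if k: "lo \<le> k" "k < hi" for k
  proof -
    define M where "M = Max ((\<lambda>k. \<bar>h (Suc k) - h k\<bar>) ` {lo..<hi})"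
    have M_ge: "\<bar>h (Suc j) - h j\<bar> \<le> M" if "lo \<le> j" "j < hi" for j
      using that unfolding M_def by (intro Max_ge) auto
    have M0: "M \<ge> 0" using M_ge[OF k] by linarith
    have "M \<in> (\<lambda>k. \<bar>h (Suc k) - h k\<bar>) ` {lo..<hi}"
      using k unfolding M_def by (intro Max_in) auto
    then obtain j where j: "lo \<le> j" "j < hi" "M = \<bar>h (Suc j) - h j\<bar>" by auto
    \<comment> \<open>Extending \<open>h\<close> constantly outside \<open>{lo..hi}\<close> makes it globally \<open>M\<close>-Lipschitz at the cost of the tails.\<close>
    define g where "g i = h (max lo (min hi i))" for i
    have g: "\<bar>g (Suc i) - g i\<bar> \<le> M" for i
    proof (cases "lo \<le> i \<and> i < hi")
      case True
      then show ?thesis using M_ge[of i] by (simp add: g_def)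
    next
      case False
      then have "max lo (min hi (Suc i)) = max lo (min hi i)" using k by auto
      then show ?thesis using M0 by (simp add: g_def)
    qed
    let ?E = "\<lambda>k. measure_pmf.expectation (binomial_pmf n (r k))"
    have gh: "\<bar>?E i h - ?E i g\<bar> \<le> e" if i: "lo \<le> i" "i \<le> hi" for i
    proof -
      let ?I = "indicator (- {lo..hi}) :: nat \<Rightarrow> real"
      have int: "integrable (measure_pmf (binomial_pmf n (r i))) f" for f :: "nat \<Rightarrow> real"
        using r01 i by (intro integrable_binomial_pmf)
      \<comment> \<open>Off the interval both values lie in [0,1], so they differ by at most
        1.\<close>
      have "\<bar>h l - g l\<bar> \<le> ?I l" for l
        using h01[of l] h01[of "max lo (min hi l)"] by (auto simp: g_def indicator_def)
      then have "h l \<le> g l + ?I l" "g l \<le> h l + ?I l" for l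
        by (smt (verit))+
      then have "?E i h \<le> ?E i (\<lambda>l. g l + ?I l)" "?E i g \<le> ?E i (\<lambda>l. h l + ?I l)"
        using r01 i by (intro expectation_binomial_pmf_mono; blast)+
      moreover have "?E i (\<lambda>l. f l + ?I l) = ?E i f + measure_pmf.prob (binomial_pmf n (r i)) (- {lo..hi})"
        for f
        by (subst Bochner_Integration.integral_add[OF int int]) simp
      ultimately show ?thesis using tail[OF i] by simp
    qed
    have "\<bar>?E (Suc j) g - ?E j g\<bar> \<le> n * M * \<bar>r (Suc j) - r j\<bar>"
      using r01 j g by (intro expectation_binomial_pmf_lipschitz) auto
    also have "\<dots> = M * (n * \<bar>r (Suc j) - r j\<bar>)" by simp
    also have "\<dots> \<le> M * \<theta>"
      using contr[of j] j M0 by (intro mult_left_mono) auto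
    \<comment> \<open>Replacing \<open>h\<close> by \<open>g\<close> costs \<open>e\<close> at each
      of \<open>j\<close> and \<open>Suc j\<close>.\<close>
    finally have "M \<le> M * \<theta> + 2 * e"
      using gh[of j] gh[of "Suc j"] harm[of j] harm[of "Suc j"] j by (simp add: abs_le_iff)
    then have "M \<le> 2 * e / (1 - \<theta>)"
      using \<open>\<theta> < 1\<close> by (simp add: field_simps)
    then show ?thesis using M_ge[OF k] by linarith
  qed
  have "\<bar>h b - h a\<bar> \<le> real (b - a) * (2 * e / (1 - \<theta>))"
    using ab(2,3)
  proof (induction b rule: dec_induct)
    case (step m)
    then have "\<bar>h (Suc m) - h m\<bar> \<le> 2 * e / (1 - \<theta>)" using \<open>lo \<le> a\<close> by (intro incr) auto
    moreover have "real (Suc m - a) * (2 * e / (1 - \<theta>)) =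
        real (m - a) * (2 * e / (1 - \<theta>)) + 2 * e / (1 - \<theta>)"
      using step by (simp add: Suc_diff_le distrib_right del: times_divide_eq_right)
    ultimately show ?case using step by linarith
  qed simp
  also have "\<dots> \<le> n * (2 * e / (1 - \<theta>))"
    using ab assms(2) e \<open>\<theta> < 1\<close> by (intro mult_right_mono) auto
  finally show ?thesis .
qed

section \<open>The two-color drift polynomial\<close>

definition two_color_prob :: "nat \<Rightarrow> nat \<Rightarrow> real \<Rightarrow> real" where
  "two_color_prob A G p = p ^ 3 + A * p\<^sup>2 * (1 - p) + G * p * (1 - p)\<^sup>2"

text \<open>The last factor interpolates linearly between \<open>G - 1\<close> at p = 0 and
  \<open>A - 2\<close> at p = 1, so these two numbers decide the sign of the drift.\<close>

lemma two_color_prob_drift: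
  "two_color_prob A G p - p = p * (1 - p) * ((real G - 1) * (1 - p) + (real A - 2) * p)"
  unfolding two_color_prob_def by (simp add: algebra_simps power2_eq_square power3_eq_cube)

lemma two_color_prob_in_01:
  assumes "0 < p" "p < 1" "A \<le> 3" "G \<le> 3"
  shows "0 < two_color_prob A G p \<and> two_color_prob A G p < 1"
proof
  show "0 < two_color_prob A G p"
    using assms unfolding two_color_prob_def by (auto intro!: add_pos_nonneg)
  \<comment> \<open>The same form for the other color: p and 1 - p trade places, and A and G become
    3 - G and 3 - A.\<close>
  have "1 - two_color_prob A G p =
      (1 - p) ^ 3 + (3 - real G) * (p * (1 - p)\<^sup>2) + (3 - real A) * (p\<^sup>2 * (1 - p))"
    unfolding two_color_prob_def by (simp add: algebra_simps power2_eq_square power3_eq_cube)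
  also have "\<dots> > 0"
    using assms by (auto intro!: add_pos_nonneg)
  finally show "two_color_prob A G p < 1" by simp
qed

lemma two_color_prob_contraction:
  assumes "A \<le> 1" "2 \<le> G" "G \<le> 3" "3/10 \<le> x" "x \<le> y" "y \<le> 7/10"
  shows "0 \<le> two_color_prob A G y - two_color_prob A G x"
    and "two_color_prob A G y - two_color_prob A G x \<le> 82/100 * (y - x)"
proof -
  let ?q' = "\<lambda>p. real G + 2 * (real A - 2 * G) * p + 3 * (1 - real A + G) * p\<^sup>2"
  have "0 \<le> two_color_prob A G y - two_color_prob A G x \<and>
    two_color_prob A G y - two_color_prob A G x \<le> 82/100 * (y - x)"
  proof (cases "x < y")
    case True
    have "(two_color_prob A G has_real_derivative ?q' p) (at p)" for p
      unfolding two_color_prob_def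
      by (auto intro!: derivative_eq_intros simp: algebra_simps power2_eq_square)
    then obtain z where z: "x < z" "z < y"
      "two_color_prob A G y - two_color_prob A G x = (y - x) * ?q' z"
      using MVT2[OF True, of "two_color_prob A G" ?q'] by blast
    \<comment> \<open>The square lies below its chord over [3/10, 7/10] and above its tangent at
      1/2, which makes the bounds on \<open>?q'\<close> linear. The largest slope is 81/100, for A =
      0, G = 2 at 7/10 and for A = 1, G = 3 at 3/10.\<close>
    have "(z - 3/10) * (7/10 - z) \<ge> 0" "(z - 1/2)\<^sup>2 \<ge> 0"
      using z assms by auto
    then have "z\<^sup>2 \<le> z - 21/100" "z\<^sup>2 \<ge> z - 1/4"
      by (simp_all add: algebra_simps power2_eq_square)
    moreover have "A = 0 \<or> A = 1" "G = 2 \<or> G = 3" using assms by auto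
    ultimately have "0 \<le> ?q' z" "?q' z \<le> 82/100"
      using z assms by auto
    then show ?thesis
      using True unfolding z(3)
      by (metis diff_ge_0_iff_ge less_eq_real_def mult.commute mult_left_mono mult_nonneg_nonneg)
  qed (use assms in simp)
  then show "0 \<le> two_color_prob A G y - two_color_prob A G x"
    "two_color_prob A G y - two_color_prob A G x \<le> 82/100 * (y - x)" by auto
qed

text \<open>Monotonicity reduces this to the endpoints. The distance 2/100 to 3/10 and 7/10 is room
  for the random deviation of one round.\<close>

lemma two_color_prob_confined:
  assumes "A \<le> 1" "2 \<le> G" "G \<le> 3" "3/10 \<le> x" "x \<le> 7/10"
  shows "32/100 \<le> two_color_prob A G x" "two_color_prob A G x \<le> 68/100"
proof -
  have AG: "A = 0 \<or> A = 1" "G = 2 \<or> G = 3" using assms by auto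
  have "32/100 \<le> two_color_prob A G (3/10)" "two_color_prob A G (7/10) \<le> 68/100"
    using AG by (auto simp: two_color_prob_def power2_eq_square power3_eq_cube)
  then show "32/100 \<le> two_color_prob A G x" "two_color_prob A G x \<le> 68/100"
    using two_color_prob_contraction(1)[of A G "3/10" x] two_color_prob_contraction(1)[of A G x "7/10"]
      assms by auto
qed

text \<open>Hoeffding's inequality for the fraction of successes.\<close>

lemma prob_binomial_pmf_deviation:
  assumes "n > 0" "p \<in> {0..1}" "\<epsilon> \<ge> 0"
  shows "measure_pmf.prob (binomial_pmf n p) {x. \<bar>x / n - p\<bar> \<ge> \<epsilon>} \<le> 2 * exp (- 2 * real n * \<epsilon>\<^sup>2)"
  using binomial_distribution.prob_abs_ge'[of p n \<epsilon>] assms by (simp add: binomial_distribution_def)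

text \<open>Here \<open>h k\<close> stands for the probability that the first color wins when it has
  k of the n nodes. The two starting points, near 3n/8 and 5n/8, are at least n/4 apart, which is
  the bias the solver asks for.\<close>

lemma two_color_harmonic_classification:
  "\<exists>n0. \<forall>n\<ge>n0. \<forall>A\<le>3. \<forall>G\<le>3. \<forall>h::nat \<Rightarrow> real.
     (\<forall>k. 0 \<le> h k \<and> h k \<le> 1) \<longrightarrow> h 0 = 0 \<longrightarrow> h n = 1 \<longrightarrow>
     (\<forall>k\<le>n. h k = measure_pmf.expectation (binomial_pmf n (two_color_prob A G (real k / n))) h) \<longrightarrow>
     3/4 \<le> h (n - 3 * n div 8) \<longrightarrow> h (3 * n div 8) \<le> 1/4 \<longrightarrow> A = 3 \<and> G = 0"
proof -
  \<comment> \<open>The Hoeffding bound for a deviation of 2/100; it is geometric in n and hence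
    beats the factor n of the oscillation bound.\<close>
  define e :: "nat \<Rightarrow> real" where "e n = 2 * exp (- 2 * real n * (2/100)\<^sup>2)" for n
  have "(\<lambda>n. real n * exp (- 2 * (2/100)\<^sup>2) ^ n) \<longlonglongrightarrow> 0"
    by (rule powser_times_n_limit_0) simp
  then have "(\<lambda>n. (real n * exp (- 2 * (2/100)\<^sup>2) ^ n) * (4 / (1 - 82/100))) \<longlonglongrightarrow> 0"
    by (rule tendsto_mult_left_zero)
  moreover have "(real n * exp (- 2 * (2/100)\<^sup>2) ^ n) * (4 / (1 - 82/100)) = n * (2 * e n / (1 - 82/100))" for n
    by (simp add: e_def exp_of_nat_mult[symmetric] mult.commute)
  ultimately have "(\<lambda>n. n * (2 * e n / (1 - 82/100))) \<longlonglongrightarrow> 0"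
    by (simp only:)
  then have "eventually (\<lambda>n. n * (2 * e n / (1 - 82/100)) < 1/2) sequentially"
    by (rule order_tendstoD) simp
  then obtain n1 where n1: "n * (2 * e n / (1 - 82/100)) < 1/2" if "n \<ge> n1" for n
    unfolding eventually_sequentially by blast
  show ?thesis
  \<comment> \<open>From n = 20 on, both rounded starting points lie in [3n/10, 7n/10] and strictly
    between n/4 and 3n/4.\<close>
  proof (intro exI[of _ "max n1 20"] allI impI, rule ccontr)
    fix n A G :: nat and h :: "nat \<Rightarrow> real"
    assume n: "max n1 20 \<le> n" and AG: "A \<le> 3" "G \<le> 3"
      and h01: "\<forall>k. 0 \<le> h k \<and> h k \<le> 1" and h0: "h 0 = 0" and hn: "h n = 1"
      and harm: "\<forall>k\<le>n. h k = measure_pmf.expectation (binomial_pmf n (two_color_prob A G (real k / n))) h"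
      and hi: "3/4 \<le> h (n - 3 * n div 8)" and lo: "h (3 * n div 8) \<le> 1/4"
      and contra: "\<not> (A = 3 \<and> G = 0)"
    let ?a = "3 * n div 8" and ?b = "n - 3 * n div 8"
    let ?r = "\<lambda>k. two_color_prob A G (real k / n)"
    have n20: "n \<ge> 20" "n > 0" using n by auto
    have "3 * n \<le> 8 * ?a + 7" "8 * ?a \<le> 3 * n" by presburger+
    then have a: "3 * real n \<le> 8 * real ?a + 7" "8 * real ?a \<le> 3 * real n" "?a \<le> n"
      by linarith+
    then have b: "real ?b = real n - real ?a" by simp
    have r01: "0 < ?r k \<and> ?r k < 1" if "0 < k" "k < n" for k
      using that AG by (intro two_color_prob_in_01) auto
    have int: "integrable (measure_pmf (binomial_pmf n (?r k))) f"
      if "0 < k" "k < n" for f :: "nat \<Rightarrow> real" and k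
      using r01[OF that] by (intro integrable_binomial_pmf) auto
    have diff: "measure_pmf.expectation (binomial_pmf n (?r k)) (\<lambda>j. h j - real j / n) = h k - ?r k"
      "measure_pmf.expectation (binomial_pmf n (?r k)) (\<lambda>j. real j / n - h j) = ?r k - h k"
      if "0 < k" "k < n" for k
      using r01[OF that] harm that
      by (simp_all only: Bochner_Integration.integral_diff[OF int[OF that] int[OF that]]) (use n20 in \<open>auto simp: expectation_binomial_pmf_real\<close>)
    \<comment> \<open>Signs of \<open>G - 1\<close> and \<open>A - 2\<close>: both at most 0, both
      at least 0, or positive at p = 0 and negative at p = 1. The only other pattern is A = 3, G =
      0.\<close>
    consider "A \<le> 2" "G \<le> 1" | "A \<ge> 2" "G \<ge> 1" | "A \<le> 1" "G \<ge> 2"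
      using contra AG by linarith
    then show False
    proof cases
      case 1
      have drift: "?r k - real k / n \<le> 0" if "k \<le> n" for k
      proof -
        have p: "0 \<le> real k / n" "0 \<le> 1 - real k / n" using that by (auto simp: divide_simps)
        then have "(real G - 1) * (1 - real k / n) \<le> 0" "(real A - 2) * (real k / n) \<le> 0"
          using 1 by (intro mult_nonpos_nonneg; simp)+
        then show ?thesis
          unfolding two_color_prob_drift using p by (intro mult_nonneg_nonpos mult_nonneg_nonneg) auto
      qed
      \<comment> \<open>The binomial mean of j / n is \<open>?r k\<close>, so a drift of constant
        sign makes the difference of \<open>h\<close> and the fraction submean; it vanishes at 0 and
        n.\<close>
      have "h ?b - real ?b / n \<le> 0"
      proof (rule binomial_maximum_principle[where n = n and r = ?r and u = "\<lambda>k. h k - real k / n"])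
        fix c assume c: "0 < c" "c < n"
        show "0 < ?r c \<and> ?r c < 1" by (rule r01[OF c])
        show "h c - real c / n \<le> measure_pmf.expectation (binomial_pmf n (?r c)) (\<lambda>k. h k - real k / n)"
          unfolding diff(1)[OF c] using drift[of c] c by simp
      qed (use h0 hn n20 in simp_all)
      then have "3/4 \<le> real ?b / n" using hi by linarith
      then have "3/4 * n \<le> real ?b" using n20 by (simp only: le_divide_eq)
      then show False using a b n20 by linarith
    next
      case 2
      have drift: "?r k - real k / n \<ge> 0" if "k \<le> n" for k
        unfolding two_color_prob_drift using 2 that
        by (intro mult_nonneg_nonneg add_nonneg_nonneg) (auto simp: divide_simps)
      have "real ?a / n - h ?a \<le> 0"
      proof (rule binomial_maximum_principle[where n = n and r = ?r and u = "\<lambda>k. real k / n - h k"])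
        fix c assume c: "0 < c" "c < n"
        show "0 < ?r c \<and> ?r c < 1" by (rule r01[OF c])
        show "real c / n - h c \<le> measure_pmf.expectation (binomial_pmf n (?r c)) (\<lambda>k. real k / n - h k)"
          unfolding diff(2)[OF c] using drift[of c] c by simp
      qed (use h0 hn n20 a in simp_all)
      then have "real ?a / n \<le> 1/4" using lo by linarith
      then have "real ?a \<le> 1/4 * n" using n20 by (simp only: divide_le_eq)
      then show False using a n20 by linarith
    next
      case 3
      define lo hi where "lo = nat \<lceil>3/10 * real n\<rceil>" and "hi = nat \<lfloor>7/10 * real n\<rfloor>"
      have lo_iff: "lo \<le> k \<longleftrightarrow> 3/10 * real n \<le> k" and hi_iff: "k \<le> hi \<longleftrightarrow> k \<le> 7/10 * real n" for k
        unfolding lo_def hi_def by linarith+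
      have frac: "3/10 \<le> real k / n" "real k / n \<le> 7/10" if "lo \<le> k" "k \<le> hi" for k
        using that n20 by (auto simp: lo_iff hi_iff field_simps)
      have conf: "32/100 \<le> ?r k" "?r k \<le> 68/100" if "lo \<le> k" "k \<le> hi" for k
        using two_color_prob_confined[OF 3 AG(2) frac[OF that]] by auto
      \<comment> \<open>The drift points to the middle, so \<open>h\<close> is almost constant
        there, against the required rise of 1/2.\<close>
      have "\<bar>h ?b - h ?a\<bar> \<le> n * (2 * e n / (1 - 82/100))"
      proof (rule binomial_harmonic_oscillation[where r = ?r and lo = lo and hi = hi and h = h])
        show "hi \<le> n" unfolding hi_def by linarith
        show "lo \<le> ?a" "?b \<le> hi" using a b n20 by (auto simp: lo_iff hi_iff)
        show "?a \<le> ?b" using a by linarith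
        fix k assume k: "lo \<le> k" "k \<le> hi"
        then show r: "?r k \<in> {0..1}" using conf[OF k] by auto
        show "h k = measure_pmf.expectation (binomial_pmf n (?r k)) h"
          using k \<open>hi \<le> n\<close> harm by auto
        have "\<bar>real j / n - ?r k\<bar> \<ge> 2/100" if "j \<notin> {lo..hi}" for j
        proof -
          have "j < 3/10 * real n \<or> j > 7/10 * real n" using that lo_iff hi_iff by auto
          then have "real j / n < 3/10 \<or> real j / n > 7/10" using n20 by (auto simp: field_simps)
          then show ?thesis using conf[OF k] by linarith
        qed
        then have "measure_pmf.prob (binomial_pmf n (?r k)) (- {lo..hi}) \<le>
            measure_pmf.prob (binomial_pmf n (?r k)) {j. \<bar>real j / n - ?r k\<bar> \<ge> 2/100}"
          by (intro measure_pmf.finite_measure_mono) auto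
        also have "\<dots> \<le> e n"
          unfolding e_def using n20 r by (intro prob_binomial_pmf_deviation) auto
        finally show "measure_pmf.prob (binomial_pmf n (?r k)) (- {lo..hi}) \<le> e n" .
      next
        fix k assume k: "lo \<le> k" "k < hi"
        have "0 \<le> ?r (Suc k) - ?r k" "?r (Suc k) - ?r k \<le> 82/100 * (real (Suc k) / n - real k / n)"
          using frac[of k] frac[of "Suc k"] k 3 AG
          by (intro two_color_prob_contraction; auto simp: divide_simps)+
        then show "n * \<bar>?r (Suc k) - ?r k\<bar> \<le> 82/100"
          using n20 by (simp add: field_simps)
      qed (use h01 n20 in auto)
      also have "\<dots> < 1/2" using n1 n by simp
      finally show False using hi lo by linarith
    qed
  qed
qed


subsection \<open>Two and three colors\<close>

lemma plurality_color_eqI: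
  assumes "m \<in> {1..k}" "\<And>j. j \<in> {1..k} - {m} \<Longrightarrow> c j < c m"
  shows "plurality_color k c = m"
proof -
  have "is_arg_max c (\<lambda>j. j \<in> {1..k}) = (\<lambda>j. j = m)"
    using assms by (fastforce simp: is_arg_max_def not_less)
  then show ?thesis
    unfolding plurality_color_def arg_max_on_def arg_max_def by (simp only: some_eq_trivial)
qed

text \<open>The bound on \<open>c m\<close> itself deals with the 0 inserted in
  \<open>second_largest\<close>, the only competitor when k = 1.\<close>

lemma biasedI:
  assumes "m \<in> {1..k}" "s > 0" "real (c m) \<ge> s"
    and lead: "\<And>j. j \<in> {1..k} - {m} \<Longrightarrow> real (c j) + s \<le> real (c m)"
  shows "biased k s c"
proof -
  have less: "c j < c m" if "j \<in> {1..k} - {m}" for j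
    using lead[OF that] assms(2) by linarith
  have "plurality_color k c = m"
    using assms(1) less by (rule plurality_color_eqI)
  moreover have "Max (c ` {1..k}) = c m"
  proof (rule Max_eqI)
    fix y assume "y \<in> c ` {1..k}"
    then show "y \<le> c m" using less by (cases "y = c m") (force intro: less_imp_le)+
  qed (use assms(1) in auto)
  moreover have "real (Max (insert 0 (c ` ({1..k} - {m})))) + s \<le> c m"
  proof -
    have "Max (insert 0 (c ` ({1..k} - {m}))) \<in> insert 0 (c ` ({1..k} - {m}))"
      by (rule Max_in) auto
    then show ?thesis
    proof
      assume "Max (insert 0 (c ` ({1..k} - {m}))) \<in> c ` ({1..k} - {m})"
      then obtain j where "j \<in> {1..k} - {m}" "Max (insert 0 (c ` ({1..k} - {m}))) = c j" by blast
      then show ?thesis using lead[of j] by simp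
    qed (use assms(3) in simp)
  qed
  ultimately show ?thesis
    unfolding biased_def bias_def second_largest_def by simp
qed

lemma solver_mono:
  assumes "solver n k f s \<epsilon>" "s \<le> s'"
  shows "solver n k f s' \<epsilon>"
  using assms unfolding solver_def biased_def by (meson order_trans)

lemma solver_imp_win:
  assumes "solver n k f s \<epsilon>" "m \<in> {1..k}" "s > 0" "real (color_count n x m) \<ge> s"
    and x: "\<And>v. v < n \<Longrightarrow> x v \<in> {1..k}"
    and lead: "\<And>j. j \<in> {1..k} - {m} \<Longrightarrow> real (color_count n x j) + s \<le> real (color_count n x m)"
  shows "win n f m x \<ge> 1 - \<epsilon>"
proof -
  let ?c = "color_count n x"
  have "(\<Sum>j\<in>{1..k}. ?c j) = (\<Sum>j\<in>{1..k}. \<Sum>v\<in>{v \<in> {..<n}. x v = j}. 1)"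
    by (simp add: color_count_def)
  also have "\<dots> = (\<Sum>v<n. 1)"
    using x by (intro sum.group) auto
  finally have "configuration n k ?c"
    by (simp add: configuration_def)
  moreover have "biased k s ?c"
    using assms by (intro biasedI[of m]) auto
  moreover have "has_configuration n k x ?c"
    using x by (simp add: has_configuration_def color_count_def)
  moreover have "plurality_color k ?c = m"
    using assms(2,3) lead by (intro plurality_color_eqI) force+
  ultimately show ?thesis
    using assms(1) unfolding solver_def win_def by blast
qed

lemma color_law_cong:
  assumes "n > 0" "\<And>i. color_count n x i = color_count n y i"
  shows "color_law n f x = color_law n f y"
proof (rule pmf_eqI)
  fix c
  let ?S = "x ` {..<n} \<union> y ` {..<n}"
  show "pmf (color_law n f x) c = pmf (color_law n f y) c"
    using assms by (simp add: pmf_color_law[where S = ?S])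
qed

text \<open>The law of the next round depends on the color counts alone, and \<open>win\<close> is
  an average over that law. Winning probabilities are thus functions of the configuration.\<close>

lemma win_color_count_cong:
  assumes "n > 0" "f (m, m, m) = m" "\<And>i. color_count n x i = color_count n y i"
  shows "win n f m x = win n f m y"
  using win_color_law[where f = f and x = x, OF assms(1,2)]
    win_color_law[where f = f and x = y, OF assms(1,2)]
    color_law_cong[of n x y f, OF assms(1,3)] by simp

lemma set_pmf_color_law:
  assumes "n > 0" "\<And>v. v < n \<Longrightarrow> x v \<in> S"
    and "\<And>i j l. i \<in> S \<Longrightarrow> j \<in> S \<Longrightarrow> l \<in> S \<Longrightarrow> f (i, j, l) \<in> S"
  shows "set_pmf (color_law n f x) \<subseteq> S"
proof -
  have "set_pmf (pmf_of_set ({..<n} \<times> {..<n} \<times> {..<n})) = {..<n} \<times> {..<n} \<times> {..<n}"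
    using assms(1) by (intro set_pmf_of_set) auto
  then show ?thesis using assms unfolding color_law_def by auto
qed

lemma set_Pi_pmf_component:
  assumes "y \<in> set_pmf (Pi_pmf {..<n} d (\<lambda>_. P))" "v < (n::nat)"
  shows "y v \<in> set_pmf P"
  using assms by (subst (asm) set_Pi_pmf) (auto simp: PiE_dflt_def)

lemma three_dynamics_same:
  assumes "three_dynamics k f" "m \<in> {1..k}"
  shows "f (m, m, m) = m"
  using assms unfolding three_dynamics_def by blast

section \<open>Two colors and the clear-majority property\<close>

definition two_coloring :: "color \<Rightarrow> color \<Rightarrow> nat \<Rightarrow> coloring" where
  "two_coloring r b c v = (if v < c then r else b)"

lemma color_count_two_coloring:
  assumes "r \<noteq> b" "c \<le> n"
  shows "color_count n (two_coloring r b c) i = (if i = r then c else if i = b then n - c else 0)"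
proof -
  have "{v. v < n \<and> two_coloring r b c v = i} = (if i = r then {..<c} else if i = b then {c..<n} else {})"
    using assms by (auto simp: two_coloring_def)
  then show ?thesis by (simp add: color_count_def)
qed

text \<open>With two colors one count fixes the configuration, so each such coloring can be replaced
  by a canonical one and the process becomes a chain on {0..n}.\<close>

lemma color_count_two_colors:
  assumes "r \<noteq> b" "\<And>v. v < n \<Longrightarrow> y v \<in> {r, b}"
  shows "color_count n y i = color_count n (two_coloring r b (color_count n y r)) i"
proof -
  have "color_count n y r \<le> n"
    unfolding color_count_def by (rule order_trans[OF card_mono[of "{..<n}"]]) auto
  moreover have "color_count n y b = n - color_count n y r"
  proof -
    have "{v. v < n \<and> y v = b} = {..<n} - {v. v < n \<and> y v = r}"
      using assms by auto
    then show ?thesis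
      unfolding color_count_def by (simp only:) (subst card_Diff_subset, auto)
  qed
  moreover have "color_count n y i = 0" if "i \<noteq> r" "i \<noteq> b"
    using assms that unfolding color_count_def by auto
  ultimately show ?thesis
    using assms(1) by (auto simp: color_count_two_coloring)
qed

lemma win_two_coloring_harmonic:
  fixes f r b
  defines "A \<equiv> of_bool (f (r, r, b) = r) + of_bool (f (r, b, r) = r) + of_bool (f (b, r, r) = r)"
    and "G \<equiv> of_bool (f (r, b, b) = r) + of_bool (f (b, r, b) = r) + of_bool (f (b, b, r) = r)"
  assumes "n > 0" "r \<noteq> b" "f (r, r, r) = r" "f (b, b, b) = b"
    and closed: "\<And>i j l. i \<in> {r, b} \<Longrightarrow> j \<in> {r, b} \<Longrightarrow> l \<in> {r, b} \<Longrightarrow> f (i, j, l) \<in> {r, b}"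
    and "c \<le> n"
  shows "win n f r (two_coloring r b c) =
    measure_pmf.expectation (binomial_pmf n (two_color_prob A G (real c / n)))
      (\<lambda>j. win n f r (two_coloring r b j))"
proof -
  let ?x = "two_coloring r b c"
  let ?M = "Pi_pmf {..<n} b (\<lambda>_. color_law n f ?x)"
  have x: "?x v \<in> {r, b}" for v by (simp add: two_coloring_def)
  define p where "p = real c / n"
  have p: "real (color_count n ?x r) / n = p" "real (color_count n ?x b) / n = 1 - p"
    using assms by (simp_all add: p_def of_nat_diff diff_divide_distrib color_count_two_coloring)
  define w :: "nat \<Rightarrow> nat \<Rightarrow> nat \<Rightarrow> real" where "w i j l = of_bool (f (i, j, l) = r)" for i j l
  have w: "w r r r = 1" "w b b b = 0"
    using assms(4-6) by (simp_all add: w_def)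
  have AG: "real A = w r r b + w r b r + w b r r" "real G = w r b b + w b r b + w b b r"
    by (simp_all add: A_def G_def w_def)
  define P where "P i = real (color_count n ?x i) / n" for i
  have P: "P r = p" "P b = 1 - p"
    using p by (simp_all add: P_def)
  have "pmf (color_law n f ?x) r =
      (\<Sum>i\<in>{r, b}. \<Sum>j\<in>{r, b}. \<Sum>l\<in>{r, b}. P i * P j * P l * w i j l)"
    unfolding P_def w_def using assms(3) x by (intro pmf_color_law) auto
  \<comment> \<open>Of the eight color triples, r r r always and b b b never yields r; the six mixed
    ones are collected in A and G.\<close>
  also have "\<dots> = two_color_prob A G p"
    using assms(4)
    by (simp add: P w two_color_prob_def AG algebra_simps power2_eq_square power3_eq_cube)
  finally have "pmf (color_law n f ?x) r = two_color_prob A G p" .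
  then have bin: "binomial_pmf n (two_color_prob A G (real c / n)) = map_pmf (\<lambda>y. color_count n y r) ?M"
    by (simp add: map_color_count_Pi_pmf p_def)
  have "win n f r ?x = measure_pmf.expectation ?M (win n f r)"
    using assms(3,5) by (rule win_color_law)
  also have "\<dots> = measure_pmf.expectation ?M (\<lambda>y. win n f r (two_coloring r b (color_count n y r)))"
  proof (rule integral_cong_AE)
    show "AE y in measure_pmf ?M. win n f r y = win n f r (two_coloring r b (color_count n y r))"
    proof (rule AE_pmfI)
      fix y assume y: "y \<in> set_pmf ?M"
      have "set_pmf (color_law n f ?x) \<subseteq> {r, b}"
        using assms(3) x closed by (rule set_pmf_color_law)
      then have "y v \<in> {r, b}" if "v < n" for v
        using set_Pi_pmf_component[OF y that] by blast
      then show "win n f r y = win n f r (two_coloring r b (color_count n y r))"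
        using assms by (intro win_color_count_cong color_count_two_colors) auto
    qed
  qed auto
  finally show ?thesis by (simp add: bin)
qed

text \<open>As \<open>f\<close> returns one of its arguments, colorings with only the colors r and b
  stay so, and the two-color classification applies for every k.\<close>

lemma solver_imp_pair_majority:
  "\<exists>n0. \<forall>n\<ge>n0. \<forall>k f r b. three_dynamics k f \<longrightarrow> solver n k f (real n / 4) (1/4) \<longrightarrow>
     r \<in> {1..k} \<longrightarrow> b \<in> {1..k} \<longrightarrow> r \<noteq> b \<longrightarrow>
     f (r, r, b) = r \<and> f (r, b, r) = r \<and> f (b, r, r) = r"
proof -
  obtain n0 where n0: "\<forall>n\<ge>n0. \<forall>A\<le>3. \<forall>G\<le>3. \<forall>h::nat \<Rightarrow> real.
     (\<forall>k. 0 \<le> h k \<and> h k \<le> 1) \<longrightarrow> h 0 = 0 \<longrightarrow> h n = 1 \<longrightarrow>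
     (\<forall>k\<le>n. h k = measure_pmf.expectation (binomial_pmf n (two_color_prob A G (real k / n))) h) \<longrightarrow>
     3/4 \<le> h (n - 3 * n div 8) \<longrightarrow> h (3 * n div 8) \<le> 1/4 \<longrightarrow> A = 3 \<and> G = 0"
    using two_color_harmonic_classification by blast
  show ?thesis
  proof (intro exI[of _ "max n0 1"] allI impI)
    fix n k f r b
    assume n: "max n0 1 \<le> n" and f: "three_dynamics k f" and solver: "solver n k f (real n / 4) (1/4)"
      and r: "r \<in> {1..k}" and b: "b \<in> {1..k}" and rb: "r \<noteq> b"
    define A :: nat where
      "A = of_bool (f (r, r, b) = r) + of_bool (f (r, b, r) = r) + of_bool (f (b, r, r) = r)"
    define G :: nat where
      "G = of_bool (f (r, b, b) = r) + of_bool (f (b, r, b) = r) + of_bool (f (b, b, r) = r)"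
    have n': "n > 0" "n0 \<le> n" using n by auto
    have fr: "f (r, r, r) = r" and fb: "f (b, b, b) = b"
      using f r b by (simp_all add: three_dynamics_same)
    have closed: "f (i, j, l) \<in> {r, b}" if "i \<in> {r, b}" "j \<in> {r, b}" "l \<in> {r, b}" for i j l
    proof -
      have "{i, j, l} \<subseteq> {1..k}" using that r b by auto
      then have "f (i, j, l) \<in> {i, j, l}" using f unfolding three_dynamics_def by blast
      then show ?thesis using that by blast
    qed
    let ?h = "\<lambda>c. win n f r (two_coloring r b c)"
    have sum: "?h c + win n f b (two_coloring r b c) \<le> 1" for c
      using n' rb fr fb by (intro win_add_le_1)
    have AG: "A \<le> 3" "G \<le> 3" unfolding A_def G_def by auto
    \<comment> \<open>From the all-b coloring b wins surely, which leaves probability 0 for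
      r.\<close>
    have "win n f b (two_coloring r b 0) = 1"
      by (rule win_consensus) (simp add: two_coloring_def)
    then have h0: "?h 0 = 0" using sum[of 0] win_nonneg[of n f r "two_coloring r b 0"] by linarith
    have hn: "?h n = 1" by (rule win_consensus) (simp add: two_coloring_def)
    have harm: "\<forall>c\<le>n. ?h c = measure_pmf.expectation (binomial_pmf n (two_color_prob A G (real c / n))) ?h"
      unfolding A_def G_def
      using win_two_coloring_harmonic[where f = f and r = r and b = b, OF n'(1) rb fr fb closed] by blast
    have le: "3 * n div 8 \<le> n" by linarith
    have gap: "real (3 * n div 8) + real n / 4 \<le> real (n - 3 * n div 8)"
      using le by (simp add: of_nat_diff)
    have "1 - 1/4 \<le> ?h (n - 3 * n div 8)"
      using gap n' by (intro solver_imp_win[OF solver r])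
        (use r b rb le in \<open>auto simp: color_count_two_coloring two_coloring_def\<close>)
    then have hi: "3/4 \<le> ?h (n - 3 * n div 8)" by simp
    \<comment> \<open>The mirrored start, where b leads; as the two colors cannot both win, this
      bounds the chance of r from above.\<close>
    have "1 - 1/4 \<le> win n f b (two_coloring r b (3 * n div 8))"
      using gap n' by (intro solver_imp_win[OF solver b])
        (use r b rb le in \<open>auto simp: color_count_two_coloring two_coloring_def\<close>)
    then have lo: "?h (3 * n div 8) \<le> 1/4" using sum[of "3 * n div 8"] by simp
    have "A = 3 \<and> G = 0"
      using n0[rule_format, of n A G ?h, OF n'(2) AG _ h0 hn _ hi lo] harm win_nonneg win_le_1 by blast
    then show "f (r, r, b) = r \<and> f (r, b, r) = r \<and> f (b, r, r) = r"
      unfolding A_def by (auto simp: of_bool_def split: if_splits)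
  qed
qed

lemma clear_majority_propertyI:
  assumes f: "three_dynamics k f"
    and pair: "\<And>r b. r \<in> {1..k} \<Longrightarrow> b \<in> {1..k} \<Longrightarrow> r \<noteq> b \<Longrightarrow>
      f (r, r, b) = r \<and> f (r, b, r) = r \<and> f (b, r, r) = r"
  shows "clear_majority_property k f"
  unfolding clear_majority_property_def
proof (intro ballI impI)
  fix x assume x: "x \<in> {1..k} \<times> {1..k} \<times> {1..k}" and cm: "clear_majority x"
  obtain a b c where abc: "x = (a, b, c)" by (cases x)
  have m: "a \<in> {1..k}" "b \<in> {1..k}" "c \<in> {1..k}" using x abc by auto
  consider "a = b" "b = c" | "a = b" "b \<noteq> c" | "a = c" "a \<noteq> b" | "b = c" "a \<noteq> b"
    using cm abc by auto
  then show "f x = majority_color x"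
    using pair m three_dynamics_same[OF f m(1)] by cases (auto simp: abc)
qed

section \<open>Three colors and the uniform property\<close>

lemma delta_eq_sum:
  assumes "r \<noteq> g" "r \<noteq> b" "g \<noteq> b"
  shows "delta f r g b y = of_bool (f (r, g, b) = y) + of_bool (f (r, b, g) = y) +
    of_bool (f (g, r, b) = y) + of_bool (f (g, b, r) = y) + of_bool (f (b, r, g) = y) +
    of_bool (f (b, g, r) = y)"
proof -
  have "delta f r g b y = (\<Sum>z\<in>perms3 r g b. of_bool (f z = y))"
    unfolding delta_def by (simp add: perms3_def Int_def)
  then show ?thesis using assms by (simp add: perms3_def)
qed

text \<open>By clear majority, y comes from all samples with at least two entries y, of probability
  p^3 + 3 p^2 (1 - p) = p^2 (3 - 2 p), and from those orderings of three distinct colors that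
  \<open>delta\<close> counts, each of probability \<open>p r * p g * p b\<close>.\<close>

lemma pmf_color_law_three_colors:
  fixes p :: "nat \<Rightarrow> real"
  assumes "n > 0" "r \<noteq> g" "r \<noteq> b" "g \<noteq> b" "\<And>v. v < n \<Longrightarrow> x v \<in> {r, g, b}"
    and "clear_majority_property k f" "{r, g, b} \<subseteq> {1..k}"
    and p: "\<And>i. p i = real (color_count n x i) / n" "p r + p g + p b = 1"
    and y: "y \<in> {r, g, b}"
  shows "pmf (color_law n f x) y = (p y)\<^sup>2 * (3 - 2 * p y) + delta f r g b y * (p r * p g * p b)"
proof -
  define w :: "nat \<Rightarrow> nat \<Rightarrow> nat \<Rightarrow> real" where "w i j l = of_bool (f (i, j, l) = y)" for i j l
  define e :: "nat \<Rightarrow> real" where "e i = of_bool (i = y)" for i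
  have w: "w i i j = e i" "w i j i = e i" "w j i i = e i"
    if "i \<in> {r, g, b}" "j \<in> {r, g, b}" for i j
  proof -
    have "i \<in> {1..k}" "j \<in> {1..k}" using that assms(7) by auto
    then have "f (i, i, j) = i" "f (i, j, i) = i" "f (j, i, i) = i"
      using assms(6)[unfolded clear_majority_property_def, rule_format, of "(i, i, j)"]
        assms(6)[unfolded clear_majority_property_def, rule_format, of "(i, j, i)"]
        assms(6)[unfolded clear_majority_property_def, rule_format, of "(j, i, i)"]
      by auto
    then show "w i i j = e i" "w i j i = e i" "w j i i = e i"
      by (simp_all add: w_def e_def)
  qed
  have delta: "real (delta f r g b y) = w r g b + w r b g + w g r b + w g b r + w b r g + w b g r"
    using assms(2-4) by (simp add: delta_eq_sum w_def)
  have "pmf (color_law n f x) y =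
      (\<Sum>i\<in>{r, g, b}. \<Sum>j\<in>{r, g, b}. \<Sum>l\<in>{r, g, b}. p i * p j * p l * w i j l)"
    unfolding p(1) w_def using assms by (intro pmf_color_law) auto
  also have "\<dots> = p r * p r * p r * e r + p g * p g * p g * e g +
      p b * p b * p b * e b +
      3 * p r * p r * (p g + p b) * e r + 3 * p g * p g * (p r + p b) * e g +
      3 * p b * p b * (p r + p g) * e b + delta f r g b y * (p r * p g * p b)"
    unfolding delta using assms(2-4) by (simp add: w algebra_simps)
  finally have law: "pmf (color_law n f x) y = \<dots>" .
  have sums: "p g + p b = 1 - p r" "p r + p b = 1 - p g" "p r + p g = 1 - p b" using p(2) by simp_all
  show ?thesis
    unfolding law sums e_def using y assms(2-4) by (auto simp: algebra_simps power2_eq_square)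
qed

text \<open>Double counting: each of the six permutations is sent to exactly one of the three
  colors.\<close>

lemma sum_delta:
  assumes "r \<noteq> g" "r \<noteq> b" "g \<noteq> b" "three_dynamics k f" "{r, g, b} \<subseteq> {1..k}"
  shows "delta f r g b r + delta f r g b g + delta f r g b b = 6"
proof -
  have "(\<Sum>y\<in>{r, g, b}. of_bool (f z = y)) = (1::nat)" if "z \<in> perms3 r g b" for z
  proof -
    have "f z \<in> {r, g, b}"
      using that assms(4,5) unfolding perms3_def three_dynamics_def by fastforce
    then show ?thesis using assms(1-3) by auto
  qed
  then have "(\<Sum>z\<in>perms3 r g b. \<Sum>y\<in>{r, g, b}. of_bool (f z = y)) = (\<Sum>z\<in>perms3 r g b. (1::nat))"
    by (rule sum.cong[OF refl])
  also have "\<dots> = 6"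
    using assms(1-3) by (simp add: perms3_def)
  finally have "(\<Sum>y\<in>{r, g, b}. \<Sum>z\<in>perms3 r g b. of_bool (f z = y)) = (6::nat)"
    by (subst sum.swap)
  moreover have "delta f r g b y = (\<Sum>z\<in>perms3 r g b. of_bool (f z = y))" for y
    unfolding delta_def by (simp add: perms3_def Int_def)
  ultimately show ?thesis using assms(1-3) by simp
qed

definition three_coloring :: "color \<Rightarrow> color \<Rightarrow> color \<Rightarrow> nat \<Rightarrow> nat \<Rightarrow> coloring" where
  "three_coloring r g b c d v = (if v < c then r else if v < c + d then g else b)"

lemma color_count_three_coloring:
  assumes "r \<noteq> g" "r \<noteq> b" "g \<noteq> b" "c + d \<le> n"
  shows "color_count n (three_coloring r g b c d) i =
    (if i = r then c else if i = g then d else if i = b then n - (c + d) else 0)"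
proof -
  have "{v. v < n \<and> three_coloring r g b c d v = i} =
      (if i = r then {..<c} else if i = g then {c..<c + d} else if i = b then {c + d..<n} else {})"
    using assms by (auto simp: three_coloring_def)
  then show ?thesis by (simp add: color_count_def)
qed

text \<open>The excess of \<open>105/10000\<close> over \<open>1/100\<close> absorbs the random deviations of one round.\<close>

lemma three_color_drift:
  fixes x y z \<alpha> \<beta> \<gamma> :: real
  assumes range: "32/100 \<le> x" "x \<le> 35/100" "32/100 \<le> y" "y \<le> 35/100" "32/100 \<le> z" "z \<le> 35/100"
    and "x \<le> y + 15/1000" "z + 1/100 \<le> y" "\<alpha> + 2 \<le> \<beta>" "\<gamma> \<le> \<beta>"
  shows "x\<^sup>2 * (3 - 2 * x) + \<alpha> * (x * y * z) + 105/10000 \<le> y\<^sup>2 * (3 - 2 * y) + \<beta> * (x * y * z)"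
    and "z\<^sup>2 * (3 - 2 * z) + \<gamma> * (x * y * z) + 105/10000 \<le> y\<^sup>2 * (3 - 2 * y) + \<beta> * (x * y * z)"
proof -
  have diff: "u\<^sup>2 * (3 - 2 * u) - v\<^sup>2 * (3 - 2 * v) = (u - v) * (3 * (u + v) - 2 * (u * u + u * v + v * v))"
    for u v :: real
    by (simp add: algebra_simps power2_eq_square)
  \<comment> \<open>Two extra permutations for y are worth at least 2 * 0.32^3 > 0.065, more than
    the 0.0225 that x can gain by its larger fraction plus the required 0.0105.\<close>
  have xyz: "x * y * z \<ge> 32/100 * (32/100) * (32/100)"
    using range by (intro mult_mono) auto
  have sq: "32/100 * (32/100) \<le> u * v \<and> u * v \<le> 35/100 * (35/100)"
    if "32/100 \<le> u" "u \<le> 35/100" "32/100 \<le> v" "v \<le> 35/100" for u v :: real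
    using that by (intro conjI mult_mono) auto
  \<comment> \<open>Secant slopes of u^2 (3 - 2 u), bounded term by term.\<close>
  have factor: "11/10 \<le> 3 * (u + v) - 2 * (u * u + u * v + v * v)"
    "3 * (u + v) - 2 * (u * u + u * v + v * v) \<le> 3/2"
    if "32/100 \<le> u" "u \<le> 35/100" "32/100 \<le> v" "v \<le> 35/100" for u v :: real
    using that sq[OF that(1,2,1,2)] sq[OF that] sq[OF that(3,4,3,4)] by simp_all
  have "x\<^sup>2 * (3 - 2 * x) - y\<^sup>2 * (3 - 2 * y) \<le> 15/1000 * (3/2)"
  proof (cases "x \<le> y")
    case True
    then show ?thesis
      unfolding diff using factor(1)[of x y] range
      by (intro order_trans[OF mult_nonpos_nonneg]) auto
  next
    case False
    then show ?thesis
      unfolding diff using factor[of x y] range assms(7) by (intro mult_mono) auto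
  qed
  moreover have "2 * (x * y * z) \<le> (\<beta> - \<alpha>) * (x * y * z)"
    using assms(9) range by (intro mult_right_mono) auto
  ultimately show "x\<^sup>2 * (3 - 2 * x) + \<alpha> * (x * y * z) + 105/10000 \<le> y\<^sup>2 * (3 - 2 * y) + \<beta> * (x * y * z)"
    using xyz by (simp add: left_diff_distrib)
  \<comment> \<open>The lead of y over z is stretched to at least 0.011, just above 0.0105.\<close>
  have "1/100 * (11/10) \<le> y\<^sup>2 * (3 - 2 * y) - z\<^sup>2 * (3 - 2 * z)"
    unfolding diff using factor(1)[of y z] range assms(8) by (intro mult_mono) auto
  moreover have "0 \<le> (\<beta> - \<gamma>) * (x * y * z)"
    using assms(10) range by (intro mult_nonneg_nonneg) auto
  ultimately show "z\<^sup>2 * (3 - 2 * z) + \<gamma> * (x * y * z) + 105/10000 \<le> y\<^sup>2 * (3 - 2 * y) + \<beta> * (x * y * z)"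
    by (simp add: left_diff_distrib)
qed

lemma prob_color_count_deviation:
  assumes "n > 0" "\<epsilon> \<ge> 0"
  shows "measure_pmf.prob (Pi_pmf {..<n} d (\<lambda>_. P)) {y. \<bar>real (color_count n y m) / n - pmf P m\<bar> \<ge> \<epsilon>}
    \<le> 2 * exp (- 2 * real n * \<epsilon>\<^sup>2)"
proof -
  have "measure_pmf.prob (Pi_pmf {..<n} d (\<lambda>_. P)) {y. \<bar>real (color_count n y m) / n - pmf P m\<bar> \<ge> \<epsilon>} =
    measure_pmf.prob (map_pmf (\<lambda>y. color_count n y m) (Pi_pmf {..<n} d (\<lambda>_. P)))
      {j. \<bar>real j / n - pmf P m\<bar> \<ge> \<epsilon>}"
    by (simp add: vimage_def)
  also have "\<dots> \<le> 2 * exp (- 2 * real n * \<epsilon>\<^sup>2)"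
    unfolding map_color_count_Pi_pmf using assms by (intro prob_binomial_pmf_deviation) (auto simp: pmf_le_1)
  finally show ?thesis .
qed

text \<open>The solver property is used twice. It gives r probability at least 3/4 from the start;
  applied one round later to g, it leaves r at most 1/4 outside a bad event of probability below
  1/2.\<close>

lemma solver_imp_uniform_triple:
  "\<exists>n0. \<forall>n\<ge>n0. \<forall>k f r g b. three_dynamics k f \<longrightarrow> clear_majority_property k f \<longrightarrow>
     solver n k f (1/100 * real n) (1/4) \<longrightarrow> {r, g, b} \<subseteq> {1..k} \<longrightarrow> r \<noteq> g \<longrightarrow> r \<noteq> b \<longrightarrow> g \<noteq> b \<longrightarrow>
     delta f r g b r + 2 \<le> delta f r g b g \<longrightarrow> delta f r g b b \<le> delta f r g b g \<longrightarrow> False"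
proof -
  \<comment> \<open>Two deviations of this size use up exactly 105/10000 - 1/100 = 1/2000.\<close>
  let ?\<epsilon> = "1/4000 :: real"
  have "(\<lambda>n. exp (- 2 * ?\<epsilon>\<^sup>2) ^ n) \<longlonglongrightarrow> 0"
    by (rule LIMSEQ_realpow_zero) simp_all
  \<comment> \<open>Three colors with two tails each give a union bound of 6 times this power, hence
    less than 1/2.\<close>
  then have "eventually (\<lambda>n. exp (- 2 * ?\<epsilon>\<^sup>2) ^ n < 1/12) sequentially"
    by (rule order_tendstoD) simp
  then obtain n1 where n1: "exp (- 2 * ?\<epsilon>\<^sup>2) ^ n < 1/12" if "n \<ge> n1" for n
    unfolding eventually_sequentially by blast
  show ?thesis
  proof (intro exI[of _ "max n1 1000"] allI impI)
    fix n k f r g b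
    assume n: "max n1 1000 \<le> n" and f: "three_dynamics k f" and cm: "clear_majority_property k f"
      and solver: "solver n k f (1/100 * real n) (1/4)" and k: "{r, g, b} \<subseteq> {1..k}"
      and dist: "r \<noteq> g" "r \<noteq> b" "g \<noteq> b"
      and delta: "delta f r g b r + 2 \<le> delta f r g b g" "delta f r g b b \<le> delta f r g b g"
    have n': "n \<ge> 1000" "n > 0" using n by auto
    define m d where "m = n div 3" and "d = nat \<lceil>1/100 * real n\<rceil>"
    have "3 * m \<le> n" "n \<le> 3 * m + 2" unfolding m_def by linarith+
    then have m: "3 * real m \<le> real n" "real n \<le> 3 * real m + 2" by linarith+
    have d: "1/100 * real n \<le> real d" "real d \<le> 1/100 * real n + 1" unfolding d_def by linarith+
    have "real d \<le> real m" using m d n' by linarith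
    then have dm: "d \<le> m" by simp
    \<comment> \<open>The rounding remainder of n div 3 goes to r, so r leads g by at least
      \<open>d\<close>, that is by at least n/100.\<close>
    define c where "c = n - 2 * m + d"
    have cm_le: "c + m \<le> n" "n - (c + m) = m - d" unfolding c_def using dm \<open>3 * m \<le> n\<close> by linarith+
    have rc: "real c = real n - 2 * real m + real d"
      unfolding c_def using \<open>3 * m \<le> n\<close> by (simp add: of_nat_diff)
    define x where "x = three_coloring r g b c m"
    have x: "x v \<in> {r, g, b}" for v by (simp add: x_def three_coloring_def)
    have cnt: "color_count n x i = (if i = r then c else if i = g then m else if i = b then m - d else 0)" for i
      unfolding x_def using color_count_three_coloring[OF dist cm_le(1)] cm_le(2) by simp
    define p where "p i = real (color_count n x i) / n" for i
    have p: "p r = c / n" "p g = m / n" "p b = (real m - real d) / n"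
      using dist dm by (simp_all add: p_def cnt of_nat_diff)
    have "p r + p g + p b = (real c + real m + (real m - real d)) / n"
      by (simp only: p add_divide_distrib)
    also have "\<dots> = 1" using n' by (simp add: rc)
    finally have p_sum: "p r + p g + p b = 1" .
    let ?q = "pmf (color_law n f x)"
    have q: "?q y = (p y)\<^sup>2 * (3 - 2 * p y) + delta f r g b y * (p r * p g * p b)" if "y \<in> {r, g, b}" for y
      using n'(2) dist x cm k p_def p_sum that by (rule pmf_color_law_three_colors)
    have diff: "p r - p g = (real c - real m) / n" "p g - p b = real d / n"
      by (simp_all add: p diff_divide_distrib)
    \<comment> \<open>The lead of r over g is at most 1/100 + 3/n, and n is at least 1000.\<close>
    have "p r - p g \<le> 15/1000" "1/100 \<le> p g - p b"
      unfolding diff using m d n' by (simp_all add: rc field_simps)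
    then have gaps: "p r \<le> p g + 15/1000" "p b + 1/100 \<le> p g" by linarith+
    have range: "32/100 \<le> p r" "p r \<le> 35/100" "32/100 \<le> p g" "p g \<le> 35/100"
        "32/100 \<le> p b" "p b \<le> 35/100"
      unfolding p using m d n' by (simp_all add: rc field_simps)
    have drift: "?q r + 105/10000 \<le> ?q g" "?q b + 105/10000 \<le> ?q g"
      using three_color_drift[OF range gaps, of "delta f r g b r" "delta f r g b g" "delta f r g b b"] delta
      by (simp_all add: q)
    let ?M = "Pi_pmf {..<n} b (\<lambda>_. color_law n f x)"
    define D where "D y = {z. \<bar>real (color_count n z y) / n - ?q y\<bar> \<ge> ?\<epsilon>}" for y
    let ?bad = "D r \<union> D g \<union> D b"
    have fix_col: "f (y, y, y) = y" if "y \<in> {r, g, b}" for y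
      using f k that by (intro three_dynamics_same) auto
    have closed: "f (i, j, l) \<in> {r, g, b}"
      if "i \<in> {r, g, b}" "j \<in> {r, g, b}" "l \<in> {r, g, b}" for i j l
    proof -
      have "{i, j, l} \<subseteq> {1..k}" using that k by auto
      then have "f (i, j, l) \<in> {i, j, l}" using f unfolding three_dynamics_def by blast
      then show ?thesis using that by blast
    qed
    have "set_pmf (color_law n f x) \<subseteq> {r, g, b}"
      using n'(2) x closed by (rule set_pmf_color_law)
    then have support: "z v \<in> {r, g, b}" if "z \<in> set_pmf ?M" "v < n" for z v
      using set_Pi_pmf_component[OF that] by blast
    have good: "win n f r z \<le> 1/4" if z: "z \<in> set_pmf ?M" "z \<notin> ?bad" for z
    proof -
      have dev: "\<bar>real (color_count n z y) / n - ?q y\<bar> < ?\<epsilon>" if "y \<in> {r, g, b}" for y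
        using z(2) that unfolding D_def by auto
      have lead: "real (color_count n z j) + 1/100 * real n \<le> real (color_count n z g)" if "j \<in> {r, b}" for j
      proof -
        have "\<bar>real (color_count n z j) / n - ?q j\<bar> < ?\<epsilon>"
          "\<bar>real (color_count n z g) / n - ?q g\<bar> < ?\<epsilon>" "?q j + 105/10000 \<le> ?q g"
          using dev drift that by auto
        then have "real (color_count n z j) / n + 1/100 \<le> real (color_count n z g) / n"
          by linarith
        from mult_right_mono[OF this, of "real n"] show ?thesis
          using n' by (simp add: distrib_right)
      qed
      have zero: "color_count n z j = 0" if "j \<notin> {r, g, b}" for j
        using support[OF z(1)] that unfolding color_count_def by auto
      have "1 - 1/4 \<le> win n f g z"
      proof (rule solver_imp_win[OF solver])
        show "g \<in> {1..k}" using k by simp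
        show "0 < 1/100 * real n" using n' by simp
        show pos: "1/100 * real n \<le> real (color_count n z g)" using lead[of r] by simp
        show "z v \<in> {1..k}" if "v < n" for v using support[OF z(1) that] k by auto
        \<comment> \<open>Colors other than r, g, b are absent; against them the lead of g is its
          own count.\<close>
        show "real (color_count n z j) + 1/100 * real n \<le> real (color_count n z g)"
          if "j \<in> {1..k} - {g}" for j
          using lead[of j] zero[of j] pos that by (cases "j \<in> {r, b}") auto
      qed
      moreover have "win n f r z + win n f g z \<le> 1"
        using n' dist fix_col by (intro win_add_le_1) auto
      ultimately show ?thesis by simp
    qed
    have "1 - 1/4 \<le> win n f r x"
    proof (rule solver_imp_win[OF solver])
      show "r \<in> {1..k}" using k by simp
      show "0 < 1/100 * real n" using n' by simp
      show "1/100 * real n \<le> real (color_count n x r)" using m d by (simp add: cnt rc)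
      show "x v \<in> {1..k}" for v using x[of v] k by auto
      show "real (color_count n x j) + 1/100 * real n \<le> real (color_count n x r)"
        if "j \<in> {1..k} - {r}" for j
        using that m d dm by (simp add: cnt rc of_nat_diff)
    qed
    also have "win n f r x = measure_pmf.expectation ?M (win n f r)"
      using n'(2) fix_col[of r] by (intro win_color_law) auto
    also have "\<dots> \<le> measure_pmf.expectation ?M (\<lambda>z. 1/4 + indicator ?bad z)"
    proof (rule integral_mono_AE)
      show "integrable (measure_pmf ?M) (win n f r)"
        by (intro measure_pmf.integrable_const_bound[where B = 1]) (auto simp: win_nonneg win_le_1)
      show "integrable (measure_pmf ?M) (\<lambda>z. 1/4 + indicator ?bad z :: real)"
        by (intro measure_pmf.integrable_const_bound[where B = 2]) (auto simp: indicator_def)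
      show "AE z in measure_pmf ?M. win n f r z \<le> 1/4 + indicator ?bad z"
      proof (rule AE_pmfI)
        fix z assume "z \<in> set_pmf ?M"
        then show "win n f r z \<le> 1/4 + indicator ?bad z"
          using good[of z] win_le_1[of n f r z] by (cases "z \<in> ?bad") auto
      qed
    qed
    also have "\<dots> = 1/4 + measure_pmf.prob ?M ?bad"
    proof (subst Bochner_Integration.integral_add)
      show "integrable (measure_pmf ?M) (indicator ?bad :: coloring \<Rightarrow> real)"
        by (intro measure_pmf.integrable_const_bound[where B = 1]) auto
    qed auto
    also have "measure_pmf.prob ?M ?bad \<le>
        measure_pmf.prob ?M (D r) + measure_pmf.prob ?M (D g) + measure_pmf.prob ?M (D b)"
      by (intro order_trans[OF measure_Un_le] add_right_mono measure_Un_le) auto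
    also have "\<dots> \<le> 2 * exp (- 2 * real n * ?\<epsilon>\<^sup>2) + 2 * exp (- 2 * real n * ?\<epsilon>\<^sup>2) + 2 * exp (- 2 * real n * ?\<epsilon>\<^sup>2)"
      unfolding D_def using n' by (intro add_mono prob_color_count_deviation) auto
    also have "\<dots> = 6 * exp (- 2 * ?\<epsilon>\<^sup>2) ^ n"
      by (simp add: exp_of_nat_mult[symmetric] mult.commute)
    also have "\<dots> < 1/2" using n1[of n] n by simp
    finally show False by simp
  qed
qed

text \<open>The largest number exceeds the others by at most 1. If it were 3 or more, the sum would
  be at least 3 + 2 + 2 = 7.\<close>

lemma balanced_triple:
  fixes R G B :: nat
  assumes "R + G + B = 6"
    "\<not> (R + 2 \<le> G \<and> B \<le> G)" "\<not> (R + 2 \<le> B \<and> G \<le> B)" "\<not> (G + 2 \<le> R \<and> B \<le> R)"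
    "\<not> (G + 2 \<le> B \<and> R \<le> B)" "\<not> (B + 2 \<le> R \<and> G \<le> R)" "\<not> (B + 2 \<le> G \<and> R \<le> G)"
  shows "R = 2 \<and> G = 2 \<and> B = 2"
proof -
  consider "R \<le> G" "B \<le> G" | "R \<le> B" "G \<le> B" | "G \<le> R" "B \<le> R" by linarith
  then show ?thesis
  proof cases
    case 1
    with assms(2,7) have "G < R + 2" "G < B + 2" by linarith+
    with 1 assms(1) show ?thesis by linarith
  next
    case 2
    with assms(3,5) have "B < R + 2" "B < G + 2" by linarith+
    with 2 assms(1) show ?thesis by linarith
  next
    case 3
    with assms(4,6) have "R < G + 2" "R < B + 2" by linarith+
    with 3 assms(1) show ?thesis by linarith
  qed
qed

lemma uniform_propertyI:
  assumes f: "three_dynamics k f"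
    and balanced: "\<And>r g b. {r, g, b} \<subseteq> {1..k} \<Longrightarrow> r \<noteq> g \<Longrightarrow> r \<noteq> b \<Longrightarrow> g \<noteq> b \<Longrightarrow>
      delta f r g b r + 2 \<le> delta f r g b g \<Longrightarrow> delta f r g b b \<le> delta f r g b g \<Longrightarrow> False"
  shows "uniform_property k f"
  unfolding uniform_property_def
proof (intro ballI impI)
  fix r g b assume k: "r \<in> {1..k}" "g \<in> {1..k}" "b \<in> {1..k}"
    and dist: "r \<noteq> g \<and> r \<noteq> b \<and> g \<noteq> b"
  let ?D = "delta f r g b"
  \<comment> \<open>\<open>delta\<close> sees the three colors only through the symmetric set
    \<open>perms3\<close>, so all six orders share the same counts.\<close>
  have unbalanced: "\<not> (?D x + 2 \<le> ?D y \<and> ?D z \<le> ?D y)"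
    if xyz: "{x, y, z} = {r, g, b}" "x \<noteq> y" "x \<noteq> z" "y \<noteq> z" "perms3 x y z = perms3 r g b" for x y z
  proof -
    have "delta f x y z = ?D"
      using xyz(5) by (simp add: delta_def fun_eq_iff)
    moreover have "{x, y, z} \<subseteq> {1..k}"
      using k unfolding xyz(1) by simp
    ultimately show ?thesis
      using balanced[OF _ xyz(2-4)] by metis
  qed
  have perms: "perms3 r b g = perms3 r g b" "perms3 g r b = perms3 r g b" "perms3 g b r = perms3 r g b"
    "perms3 b r g = perms3 r g b" "perms3 b g r = perms3 r g b"
    unfolding perms3_def by blast+
  show "?D r = 2 \<and> ?D g = 2 \<and> ?D b = 2"
  proof (rule balanced_triple)
    show "?D r + ?D g + ?D b = 6"
      using k dist f by (intro sum_delta[of r g b k]) auto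
  qed (rule unbalanced; use dist perms in blast)+
qed

theorem theorem4p8:
  shows "(\<exists>n0::nat. \<forall>n\<ge>n0. \<forall>k f.
            three_dynamics k f \<longrightarrow> solver n k f (real n / 4) (1/4) \<longrightarrow>
            clear_majority_property k f)
       \<and> (\<exists>\<eta>::real. \<eta> > 0 \<and> (\<exists>n0::nat. \<forall>n\<ge>n0. \<forall>k f.
            three_dynamics k f \<longrightarrow> solver n k f (\<eta> * real n) (1/4) \<longrightarrow>
            uniform_property k f))"
proof -
  obtain n1 where n1: "\<forall>n\<ge>n1. \<forall>k f r b. three_dynamics k f \<longrightarrow> solver n k f (real n / 4) (1/4) \<longrightarrow>
     r \<in> {1..k} \<longrightarrow> b \<in> {1..k} \<longrightarrow> r \<noteq> b \<longrightarrow>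
     f (r, r, b) = r \<and> f (r, b, r) = r \<and> f (b, r, r) = r"
    using solver_imp_pair_majority by blast
  obtain n2 where n2: "\<forall>n\<ge>n2. \<forall>k f r g b. three_dynamics k f \<longrightarrow> clear_majority_property k f \<longrightarrow>
     solver n k f (1/100 * real n) (1/4) \<longrightarrow> {r, g, b} \<subseteq> {1..k} \<longrightarrow> r \<noteq> g \<longrightarrow> r \<noteq> b \<longrightarrow> g \<noteq> b \<longrightarrow>
     delta f r g b r + 2 \<le> delta f r g b g \<longrightarrow> delta f r g b b \<le> delta f r g b g \<longrightarrow> False"
    using solver_imp_uniform_triple by blast
  have cm: "clear_majority_property k f"
    if "n1 \<le> n" "three_dynamics k f" "solver n k f (real n / 4) (1/4)" for n k f
    using n1 that by (intro clear_majority_propertyI) blast+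
  have unif: "uniform_property k f"
    if "max n1 n2 \<le> n" "three_dynamics k f" "solver n k f (1/100 * real n) (1/4)" for n k f
  proof -
    \<comment> \<open>A smaller required bias is a stronger property, so the first claim supplies
      the clear-majority property behind the three-color law.\<close>
    have "solver n k f (real n / 4) (1/4)"
      using that(3) by (rule solver_mono) simp
    then have "clear_majority_property k f" using cm[of n k f] that by simp
    then show ?thesis
      using n2[rule_format, of n k f] that by (intro uniform_propertyI) auto
  qed
  \<comment> \<open>The witness for \<eta> is the lead that g holds after one round.\<close>
  have "(0::real) < 1/100" by simp
  with cm unif show ?thesis by blast
qed

end
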